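(* Let $\sigma\ge0$ and $\gamma>0$ be fixed and set $V=\sqrt{1+\sigma}$. For small $\varepsilon>0$ let $(n^\varepsilon,u^\varepsilon,\phi^\varepsilon)$ be the solitary wave solution (defined in the context) and define \[ n_R^\varepsilon=n^\varepsilon-1-\varepsilon n_{\mathrm{KdV}},\qquad u_R^\varepsilon=u^\varepsilon-\varepsilon Vn_{\mathrm{KdV}},\qquad \phi_R^\varepsilon=\phi^\varepsilon-\varepsilon n_{\mathrm{KdV}}, \] where $n_{\mathrm{KdV}}(\xi)=\frac{3\gamma}{V}\operatorname{sech}^2\!\big(\sqrt{V\gamma/2}\,\xi\big)$. Then there exist positive constants $\varepsilon_1$ and $\alpha$, and for every non-negative integer $k$ a constant $C_k>0$, with $\varepsilon_1,\alpha$ independent of $k$ and all of them independent of $\varepsilon$, such that for all $0<\varepsilon<\varepsilon_1$, \[ \sup_{\xi\in\mathbb{R}}\Big| e^{\alpha|\xi|/2}\big((n_R^\varepsilon)^{(k)},(u_R^\varepsilon)^{(k)},(\phi_R^\varepsilon)^{(k)}\big)(\xi)\Big|\le C_k\varepsilon^2, \] where $f^{(k)}$ denotes the $k$-th derivative in $\xi$.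
   Context: For $\varepsilon>0$, consider the system in $\xi\in\mathbb{R}$: $-(V+\gamma\varepsilon)n'+(nu)'=0$, $-(V+\gamma\varepsilon)u'+uu'+\sigma n'/n=-\phi'$, $\varepsilon\phi''=e^\phi-n$, with $n\to1,u\to0,\phi\to0$ as $|\xi|\to\infty$. With $V=\sqrt{1+\sigma}$, for all sufficiently small $\varepsilon>0$ this system has a non-trivial smooth solution, unique up to translation; the "solitary wave solution" $(n^\varepsilon,u^\varepsilon,\phi^\varepsilon)$ is the translate that is even in $\xi$ and satisfies $(n^\varepsilon)',(u^\varepsilon)',(\phi^\varepsilon)'<0$ on $(0,\infty)$ (so its maximum is attained at $\xi=0$, and $n^\varepsilon>1$, $u^\varepsilon>0$, $\phi^\varepsilon>0$). The function $n_{\mathrm{KdV}}$ is the solitary wave of the KdV equation $\partial_{\bar t}v+Vv\partial_{\bar x}v+\frac{1}{2V}\partial_{\bar x}^3v=0$ with speed $\gamma$. *)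

theory Defs
  imports "HOL-Analysis.Analysis"
begin

definition kderiv :: "nat \<Rightarrow> (real \<Rightarrow> real) \<Rightarrow> real \<Rightarrow> real" where
  "kderiv k f = (deriv ^^ k) f"

definition smooth_real :: "(real \<Rightarrow> real) \<Rightarrow> bool" where
  "smooth_real f \<longleftrightarrow> (\<forall>k x. (deriv ^^ k) f differentiable (at x))"

definition sech :: "real \<Rightarrow> real" where
  "sech x = 1 / cosh x"

text \<open>The KdV solitary wave with speed gamma, V = sqrt(1+sigma).\<close>
definition n_KdV :: "real \<Rightarrow> real \<Rightarrow> real \<Rightarrow> real" where
  "n_KdV \<sigma> \<gamma> \<xi> = (let V = sqrt (1 + \<sigma>) in
      3 * \<gamma> / V * (sech (sqrt (V * \<gamma> / 2) * \<xi>))\<^sup>2)"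

text \<open>The (normalized) solitary wave solution of the Euler-Poisson travelling wave system.\<close>
definition solitary_wave ::
  "real \<Rightarrow> real \<Rightarrow> real \<Rightarrow> (real \<Rightarrow> real) \<Rightarrow> (real \<Rightarrow> real) \<Rightarrow> (real \<Rightarrow> real) \<Rightarrow> bool" where
  "solitary_wave \<sigma> \<gamma> \<epsilon> n u \<phi> \<longleftrightarrow>
     (let V = sqrt (1 + \<sigma>) in
      smooth_real n \<and> smooth_real u \<and> smooth_real \<phi> \<and>
      (\<forall>\<xi>. n \<xi> \<noteq> 0) \<and>
      (\<forall>\<xi>. - (V + \<gamma> * \<epsilon>) * deriv n \<xi> + deriv (\<lambda>x. n x * u x) \<xi> = 0) \<and>
      (\<forall>\<xi>. - (V + \<gamma> * \<epsilon>) * deriv u \<xi> + u \<xi> * deriv u \<xi> + \<sigma> * deriv n \<xi> / n \<xi>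
              = - deriv \<phi> \<xi>) \<and>
      (\<forall>\<xi>. \<epsilon> * deriv (deriv \<phi>) \<xi> = exp (\<phi> \<xi>) - n \<xi>) \<and>
      (n \<longlongrightarrow> 1) at_top \<and> (n \<longlongrightarrow> 1) at_bot \<and>
      (u \<longlongrightarrow> 0) at_top \<and> (u \<longlongrightarrow> 0) at_bot \<and>
      (\<phi> \<longlongrightarrow> 0) at_top \<and> (\<phi> \<longlongrightarrow> 0) at_bot \<and>
      \<not> (n = (\<lambda>_. 1) \<and> u = (\<lambda>_. 0) \<and> \<phi> = (\<lambda>_. 0)) \<and>
      (\<forall>\<xi>. n (-\<xi>) = n \<xi> \<and> u (-\<xi>) = u \<xi> \<and> \<phi> (-\<xi>) = \<phi> \<xi>) \<and>
      (\<forall>\<xi>>0. deriv n \<xi> < 0 \<and> deriv u \<xi> < 0 \<and> deriv \<phi> \<xi> < 0))"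

end

theory Submission
  imports Defs
begin

text \<open>
  Mass and momentum balance integrate to \<open>u = c (1 - 1 / n)\<close> and
  \<open>\<phi> = c\<^sup>2 / 2 * (1 - 1 / n\<^sup>2) - \<sigma> ln n\<close> with \<open>c = V + \<gamma> \<epsilon>\<close>. For \<open>\<psi> = \<phi> / \<epsilon>\<close>, Poisson's equation becomes
  \<open>\<psi>'' = \<kappa>\<^sup>2 \<psi> - V\<^sup>2 \<psi>\<^sup>2 + O(\<epsilon> \<psi>)\<close> with \<open>\<kappa>\<^sup>2 = 2 V \<gamma>\<close>, and its energy integral shows \<open>\<psi>(0) = 3 \<gamma> / V + O(\<epsilon>)\<close>.
  The KdV profile is linearised by \<open>y = 1 / \<psi>\<close>: the ODE and the energy integral combine to
  \<open>y'' = \<kappa>\<^sup>2 y - V\<^sup>2 / 3 + O(\<epsilon> y)\<close>, which the reciprocal of the KdV wave solves without error term. A maximum principle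
  gives \<open>y \<ge> c exp (3 \<kappa> x / 4)\<close> and an error \<open>O(\<epsilon> exp (5 \<kappa> x / 4))\<close> for \<open>y\<close>, so that
  \<open>\<psi> - n_KdV = O(\<epsilon> exp (- \<kappa> \<bar>x\<bar> / 2))\<close>. Derivatives are bounded inductively from the ODE, the first one
  by interpolation.
\<close>

section \<open>Families of functions with uniformly bounded derivatives\<close>

text \<open>The obstacle is the crest. Linearising the equation for \<psi> at \<open>n_KdV\<close>
  gives the coefficient \<kappa>^2 - 2 V^2 \<open>n_KdV\<close>, which equals -2 \<kappa>^2 at 0,
  and the translation mode solves the linearised equation; a comparison argument for the difference
  of the profiles fails there. For the reciprocal the coefficient is the positive constant
  \<kappa>^2, at the price of working with growing functions. The rates 3/4 \<kappa> and 5/4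
  \<kappa> on either side of \<kappa> leave room for the perturbation O(\<epsilon> y). Since \<psi>
  - \<open>n_KdV\<close> is the difference of the reciprocals divided by their product, the rates
  combine to 5/4 - 3/4 - 1 = -1/2. This is the origin of the weight, with \<alpha> = \<kappa>.
  Constants must precede the wave in the quantifier order, so estimates are stated for a family
  indexed by all admissible waves at once, with \<epsilon> as part of the index.\<close>

text \<open>The index \<open>s\<close> carries all parameters, so each constant is chosen before
  both \<open>s\<close> and \<open>x\<close>. Derivatives enter as witnesses, with a separate
  constant for each order up to \<open>k\<close>; product and chain rules then close by induction on
  \<open>k\<close> without handling iterated \<open>deriv\<close>.\<close>

primrec bounded_derivs ::
  "'s set \<Rightarrow> ('s \<Rightarrow> real \<Rightarrow> real) \<Rightarrow> nat \<Rightarrow> ('s \<Rightarrow> real \<Rightarrow> real) \<Rightarrow> bool" where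
  "bounded_derivs S w 0 f \<longleftrightarrow> (\<exists>C. \<forall>s\<in>S. \<forall>x. \<bar>f s x\<bar> \<le> C * w s x)"
| "bounded_derivs S w (Suc k) f \<longleftrightarrow>
     (\<exists>C. \<forall>s\<in>S. \<forall>x. \<bar>f s x\<bar> \<le> C * w s x) \<and>
     (\<exists>f'. (\<forall>s\<in>S. \<forall>x. (f s has_real_derivative f' s x) (at x)) \<and> bounded_derivs S w k f')"

lemma bounded_derivs_bound:
  assumes "bounded_derivs S w k f"
  obtains C where "C > 0" "\<And>s x. s \<in> S \<Longrightarrow> w s x \<ge> 0 \<Longrightarrow> \<bar>f s x\<bar> \<le> C * w s x"
proof -
  obtain C where C: "\<forall>s\<in>S. \<forall>x. \<bar>f s x\<bar> \<le> C * w s x"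
    using assms by (cases k) auto
  show ?thesis
  proof (rule that[of "\<bar>C\<bar> + 1"])
    fix s x assume s: "s \<in> S" and w: "w s x \<ge> 0"
    have "\<bar>f s x\<bar> \<le> C * w s x" using C s by auto
    also have "\<dots> \<le> (\<bar>C\<bar> + 1) * w s x" using w by (intro mult_right_mono) auto
    finally show "\<bar>f s x\<bar> \<le> (\<bar>C\<bar> + 1) * w s x" .
  qed auto
qed

lemma bounded_derivs_SucE:
  assumes "bounded_derivs S w (Suc k) f"
  obtains f' where "\<And>s x. s \<in> S \<Longrightarrow> (f s has_real_derivative f' s x) (at x)"
    "bounded_derivs S w k f'"
proof -
  obtain f' where "\<forall>s\<in>S. \<forall>x. (f s has_real_derivative f' s x) (at x)" "bounded_derivs S w k f'"
    using assms by auto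
  then show ?thesis by (intro that[of f']) auto
qed

lemma bounded_derivs_0: "bounded_derivs S w k f \<Longrightarrow> bounded_derivs S w 0 f"
  by (cases k) auto

lemma bounded_derivs_SucI:
  assumes "bounded_derivs S w 0 f"
    and "\<And>s x. s \<in> S \<Longrightarrow> (f s has_real_derivative f' s x) (at x)"
    and "bounded_derivs S w k f'"
  shows "bounded_derivs S w (Suc k) f"
  using assms by auto

lemma bounded_derivs_cong:
  assumes "\<And>s x. s \<in> S \<Longrightarrow> f s x = g s x"
  shows "bounded_derivs S w k f \<longleftrightarrow> bounded_derivs S w k g"
proof -
  have "f s = g s" if "s \<in> S" for s using assms that by auto
  then show ?thesis by (cases k) (simp_all cong: ball_cong)
qed

text \<open>The definition only provides some derivative; uniqueness of derivatives identifies it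
  with the given one.\<close>

lemma bounded_derivs_SucD:
  assumes "bounded_derivs S w (Suc k) f"
    and "\<And>s x. s \<in> S \<Longrightarrow> (f s has_real_derivative f' s x) (at x)"
  shows "bounded_derivs S w k f'"
proof -
  obtain g where g: "\<forall>s\<in>S. \<forall>x. (f s has_real_derivative g s x) (at x)"
    "bounded_derivs S w k g" using assms(1) by auto
  have "g s x = f' s x" if "s \<in> S" for s x
    using g(1) assms(2) that DERIV_unique by blast
  then show ?thesis using g(2) bounded_derivs_cong by metis
qed

lemma bounded_derivs_Suc_le: "bounded_derivs S w (Suc k) f \<Longrightarrow> bounded_derivs S w k f"
proof (induction k arbitrary: f)
  case (Suc k)
  then obtain f' where "\<forall>s\<in>S. \<forall>x. (f s has_real_derivative f' s x) (at x)"
    "bounded_derivs S w (Suc k) f'" by auto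
  then show ?case
    using Suc by (intro bounded_derivs_SucI[where f' = f']) (auto simp: bounded_derivs_0)
qed auto

lemma bounded_derivs_mono:
  assumes "bounded_derivs S w k f"
    and "\<And>s x. s \<in> S \<Longrightarrow> 0 \<le> w s x \<and> w s x \<le> K * w' s x"
  shows "bounded_derivs S w' k f"
  using assms(1)
proof (induction k arbitrary: f)
  case 0
  then obtain C where C: "C > 0" "\<And>s x. s \<in> S \<Longrightarrow> w s x \<ge> 0 \<Longrightarrow> \<bar>f s x\<bar> \<le> C * w s x"
    using bounded_derivs_bound by metis
  have "\<bar>f s x\<bar> \<le> (C * K) * w' s x" if "s \<in> S" for s x
  proof -
    have "\<bar>f s x\<bar> \<le> C * w s x" using C assms(2) that by blast
    also have "\<dots> \<le> C * (K * w' s x)" using C(1) assms(2) that by (intro mult_left_mono) auto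
    finally show ?thesis by (simp add: mult_ac)
  qed
  then show ?case by auto
next
  case (Suc k)
  then obtain f' where "\<forall>s\<in>S. \<forall>x. (f s has_real_derivative f' s x) (at x)"
    "bounded_derivs S w k f'" by auto
  moreover have "bounded_derivs S w' 0 f"
    using Suc bounded_derivs_0 bounded_derivs_Suc_le by blast
  ultimately show ?case
    using Suc.IH by (intro bounded_derivs_SucI[where f' = f']) auto
qed

lemma bounded_derivs_add:
  assumes "bounded_derivs S w k f" "bounded_derivs S w k g"
  shows "bounded_derivs S w k (\<lambda>s x. f s x + g s x)"
  using assms
proof (induction k arbitrary: f g)
  case 0
  then obtain C D where *: "\<forall>s\<in>S. \<forall>x. \<bar>f s x\<bar> \<le> C * w s x" "\<forall>s\<in>S. \<forall>x. \<bar>g s x\<bar> \<le> D * w s x"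
    by auto
  have "\<bar>f s x + g s x\<bar> \<le> (C + D) * w s x" if "s \<in> S" for s x
    using *[rule_format, OF that, of x] by (simp add: algebra_simps)
  then show ?case by auto
next
  case (Suc k)
  from Suc.prems obtain f' g' where *: "\<forall>s\<in>S. \<forall>x. (f s has_real_derivative f' s x) (at x)"
    "bounded_derivs S w k f'" "\<forall>s\<in>S. \<forall>x. (g s has_real_derivative g' s x) (at x)"
    "bounded_derivs S w k g'" by auto
  show ?case
  proof (rule bounded_derivs_SucI)
    show "bounded_derivs S w 0 (\<lambda>s x. f s x + g s x)"
      using Suc.IH Suc.prems bounded_derivs_Suc_le bounded_derivs_0 by blast
    show "((\<lambda>x. f s x + g s x) has_real_derivative f' s x + g' s x) (at x)" if "s \<in> S" for s x
      using * that by (auto intro!: derivative_eq_intros)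
  qed (use * Suc.IH in auto)
qed

lemma bounded_derivs_mult:
  assumes "bounded_derivs S w1 k f" "bounded_derivs S w2 k g"
    and "\<And>s x. s \<in> S \<Longrightarrow> w1 s x \<ge> 0" "\<And>s x. s \<in> S \<Longrightarrow> w2 s x \<ge> 0"
  shows "bounded_derivs S (\<lambda>s x. w1 s x * w2 s x) k (\<lambda>s x. f s x * g s x)"
  using assms(1,2)
proof (induction k arbitrary: f g)
  case 0
  obtain C where C: "C > 0" "\<And>s x. s \<in> S \<Longrightarrow> w1 s x \<ge> 0 \<Longrightarrow> \<bar>f s x\<bar> \<le> C * w1 s x"
    using bounded_derivs_bound 0(1) by metis
  obtain D where D: "D > 0" "\<And>s x. s \<in> S \<Longrightarrow> w2 s x \<ge> 0 \<Longrightarrow> \<bar>g s x\<bar> \<le> D * w2 s x"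
    using bounded_derivs_bound 0(2) by metis
  have "\<bar>f s x * g s x\<bar> \<le> (C * D) * (w1 s x * w2 s x)" if "s \<in> S" for s x
  proof -
    have "\<bar>f s x\<bar> * \<bar>g s x\<bar> \<le> (C * w1 s x) * (D * w2 s x)"
      using C D assms(3,4) that by (intro mult_mono) auto
    then show ?thesis by (simp add: abs_mult mult_ac)
  qed
  then show ?case by auto
next
  case (Suc k)
  from Suc.prems obtain f' g' where *: "\<forall>s\<in>S. \<forall>x. (f s has_real_derivative f' s x) (at x)"
    "bounded_derivs S w1 k f'" "\<forall>s\<in>S. \<forall>x. (g s has_real_derivative g' s x) (at x)"
    "bounded_derivs S w2 k g'" by auto
  have low: "bounded_derivs S w1 k f" "bounded_derivs S w2 k g"
    using Suc.prems bounded_derivs_Suc_le by blast+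
  show ?case
  proof (rule bounded_derivs_SucI)
    show "bounded_derivs S (\<lambda>s x. w1 s x * w2 s x) 0 (\<lambda>s x. f s x * g s x)"
      using Suc.IH low bounded_derivs_0 by blast
    show "((\<lambda>x. f s x * g s x) has_real_derivative f' s x * g s x + f s x * g' s x) (at x)"
      if "s \<in> S" for s x
      using * that by (auto intro!: derivative_eq_intros)
    show "bounded_derivs S (\<lambda>s x. w1 s x * w2 s x) k (\<lambda>s x. f' s x * g s x + f s x * g' s x)"
      using * low Suc.IH by (intro bounded_derivs_add) auto
  qed
qed

lemma bounded_derivs_param:
  assumes "\<And>s x. s \<in> S \<Longrightarrow> \<bar>a s\<bar> \<le> K * w s x"
  shows "bounded_derivs S w k (\<lambda>s x. a s)"
proof -
  have zero: "bounded_derivs S w k (\<lambda>s x. 0)" for k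
  proof (induction k)
    case (Suc k)
    then show ?case by (intro bounded_derivs_SucI) (auto intro: exI[of _ 0])
  qed (auto intro: exI[of _ 0])
  have "bounded_derivs S w 0 (\<lambda>s x. a s)"
    using assms by (auto intro!: exI[of _ K])
  then show ?thesis
    using zero by (cases k) (auto intro!: bounded_derivs_SucI simp del: bounded_derivs.simps)
qed

lemma bounded_derivs_param_unit:
  assumes "\<And>s. s \<in> S \<Longrightarrow> 0 < a s \<and> a s \<le> (1::real)"
  shows "bounded_derivs S (\<lambda>_ _. 1) k (\<lambda>s x. a s)"
proof (rule bounded_derivs_param)
  show "\<bar>a s\<bar> \<le> 1 * 1" if "s \<in> S" for s using assms[OF that] by simp
qed

lemma bounded_derivs_const: "bounded_derivs S (\<lambda>_ _. 1) k (\<lambda>s x. a)"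
  by (rule bounded_derivs_param[where K = "\<bar>a\<bar>"]) simp

lemma bounded_derivs_scale:
  assumes "bounded_derivs S w k f"
    and "\<And>s. s \<in> S \<Longrightarrow> a s \<ge> 0" "\<And>s x. s \<in> S \<Longrightarrow> w s x \<ge> 0"
  shows "bounded_derivs S (\<lambda>s x. a s * w s x) k (\<lambda>s x. a s * f s x)"
proof (rule bounded_derivs_mult[OF _ assms(1)])
  show "bounded_derivs S (\<lambda>s x. a s) k (\<lambda>s x. a s)"
    by (rule bounded_derivs_param[where K = 1]) (use assms(2) in auto)
qed (use assms in auto)

lemma bounded_derivs_mult_left:
  assumes "bounded_derivs S (\<lambda>_ _. 1) k f" "bounded_derivs S w k g"
    and "\<And>s x. s \<in> S \<Longrightarrow> w s x \<ge> 0"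
  shows "bounded_derivs S w k (\<lambda>s x. f s x * g s x)"
  using bounded_derivs_mult[OF assms(1,2)] assms(3) by auto

lemma bounded_derivs_mult_right:
  assumes "bounded_derivs S w k f" "bounded_derivs S (\<lambda>_ _. 1) k g"
    and "\<And>s x. s \<in> S \<Longrightarrow> w s x \<ge> 0"
  shows "bounded_derivs S w k (\<lambda>s x. f s x * g s x)"
  using bounded_derivs_mult[OF assms(1,2)] assms(3) by auto

lemma bounded_derivs_minus:
  assumes "bounded_derivs S w k f" and w: "\<And>s x. s \<in> S \<Longrightarrow> w s x \<ge> 0"
  shows "bounded_derivs S w k (\<lambda>s x. - f s x)"
  using bounded_derivs_mult_left[OF bounded_derivs_const[of S k "-1"] assms] by simp

lemma bounded_derivs_diff:
  assumes "bounded_derivs S w k f" "bounded_derivs S w k g"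
    and w: "\<And>s x. s \<in> S \<Longrightarrow> w s x \<ge> 0"
  shows "bounded_derivs S w k (\<lambda>s x. f s x - g s x)"
  using bounded_derivs_add[OF assms(1) bounded_derivs_minus[OF assms(2) w]] by simp

lemma bounded_derivs_power:
  assumes "bounded_derivs S (\<lambda>_ _. 1) k f"
  shows "bounded_derivs S (\<lambda>_ _. 1) k (\<lambda>s x. f s x ^ m)"
proof (induction m)
  case 0
  then show ?case using bounded_derivs_const[of S k 1] by simp
next
  case (Suc m)
  then show ?case using bounded_derivs_mult_left[OF assms Suc] by simp
qed

text \<open>One factor supplies the decaying weight; the other factors only need to be
  bounded.\<close>

lemma bounded_derivs_power_Suc:
  assumes "bounded_derivs S w k f" "bounded_derivs S (\<lambda>_ _. 1) k f"
    and "\<And>s x. s \<in> S \<Longrightarrow> w s x \<ge> 0" "m > 0"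
  shows "bounded_derivs S w k (\<lambda>s x. f s x ^ m)"
proof -
  obtain l where "m = Suc l" using \<open>m > 0\<close> by (cases m) auto
  then show ?thesis
    using bounded_derivs_mult_right[OF assms(1) bounded_derivs_power[OF assms(2)] assms(3)] by simp
qed

text \<open>The derivative \<open>- (f' s x * (1 / f s x) ^ 2)\<close> contains the reciprocal
  itself at one order less, so the induction hypothesis suffices.\<close>

lemma bounded_derivs_inverse:
  assumes "bounded_derivs S (\<lambda>_ _. 1) k f" and "c > 0"
    and "\<And>s x. s \<in> S \<Longrightarrow> c \<le> f s x"
  shows "bounded_derivs S (\<lambda>_ _. 1) k (\<lambda>s x. 1 / f s x)"
  using assms(1)
proof (induction k)
  case 0
  have "\<bar>1 / f s x\<bar> \<le> 1 / c * 1" if "s \<in> S" for s x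
    using assms(3)[OF that, of x] \<open>c > 0\<close> by (simp add: divide_simps)
  then show ?case by (auto simp del: abs_divide)
next
  case (Suc k)
  then obtain f' where *: "\<forall>s\<in>S. \<forall>x. (f s has_real_derivative f' s x) (at x)"
    "bounded_derivs S (\<lambda>_ _. 1) k f'" by auto
  have IH: "bounded_derivs S (\<lambda>_ _. 1) k (\<lambda>s x. 1 / f s x)"
    using Suc bounded_derivs_Suc_le by blast
  show ?case
  proof (rule bounded_derivs_SucI)
    show "bounded_derivs S (\<lambda>_ _. 1) 0 (\<lambda>s x. 1 / f s x)"
      using IH bounded_derivs_0 by blast
    show "((\<lambda>x. 1 / f s x) has_real_derivative - (f' s x * (1 / f s x) ^ 2)) (at x)"
      if "s \<in> S" for s x
    proof -
      have "f s x \<noteq> 0" using assms(2) assms(3)[OF that, of x] by auto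
      then show ?thesis
        using * that by (auto intro!: derivative_eq_intros simp: power2_eq_square divide_simps)
    qed
    show "bounded_derivs S (\<lambda>_ _. 1) k (\<lambda>s x. - (f' s x * (1 / f s x) ^ 2))"
      by (intro bounded_derivs_minus bounded_derivs_mult_left bounded_derivs_power * IH) auto
  qed
qed

text \<open>Passage from derivative witnesses to the iterated \<open>deriv\<close> in which the
  theorem is stated.\<close>

lemma bounded_derivs_kderiv:
  assumes "bounded_derivs S w k f"
  shows "\<exists>C. \<forall>s\<in>S. \<forall>x. \<bar>kderiv k (f s) x\<bar> \<le> C * w s x"
  using assms
proof (induction k arbitrary: f)
  case 0
  then show ?case by (simp add: kderiv_def)
next
  case (Suc k)
  then obtain f' where *: "\<forall>s\<in>S. \<forall>x. (f s has_real_derivative f' s x) (at x)"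
    "bounded_derivs S w k f'" by auto
  have "deriv (f s) = f' s" if "s \<in> S" for s
    using * that DERIV_imp_deriv by blast
  then have "kderiv (Suc k) (f s) = kderiv k (f' s)" if "s \<in> S" for s
    using that by (simp add: kderiv_def funpow_Suc_right del: funpow.simps)
  then show ?case using Suc.IH[OF *(2)] by (metis)
qed

section \<open>Interpolation of the first derivative between a function and its second
  derivative\<close>

text \<open>A Landau-type inequality: some \<open>z\<close> in \<open>(x, x + 1)\<close> has
  \<open>f' z\<close> equal to the increment of \<open>f\<close>, at most \<open>2 * A\<close>, and
  \<open>f''\<close> controls the change of \<open>f'\<close> between \<open>x\<close> and
  \<open>z\<close>. Only points to the right of \<open>x\<close> are used, which suits bounds that
  decay in that direction.\<close>

lemma deriv_bound_interpolation:
  fixes f :: "real \<Rightarrow> real"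
  assumes "\<And>t. (f has_real_derivative f' t) (at t)" "\<And>t. (f' has_real_derivative f'' t) (at t)"
    and A: "\<And>t. t \<ge> x \<Longrightarrow> \<bar>f t\<bar> \<le> A" and B: "\<And>t. t \<ge> x \<Longrightarrow> \<bar>f'' t\<bar> \<le> B"
  shows "\<bar>f' x\<bar> \<le> 2 * A + B"
proof -
  obtain z where z: "x < z" "z < x + 1" "f (x + 1) - f x = (x + 1 - x) * f' z"
    using MVT2[of x "x + 1" f f'] assms by auto
  obtain w where w: "x < w" "w < z" "f' z - f' x = (z - x) * f'' w"
    using MVT2[of x z f' f''] assms z by auto
  have "\<bar>(z - x) * f'' w\<bar> \<le> 1 * B"
    unfolding abs_mult using z w B[of w] by (intro mult_mono) auto
  moreover have "\<bar>f (x + 1)\<bar> \<le> A" "\<bar>f x\<bar> \<le> A" using A by auto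
  ultimately show ?thesis using z w by (simp add: abs_le_iff)
qed

text \<open>On the half-line starting at \<open>x\<close> and pointing away from the origin the
  weight is largest at \<open>x\<close>, so its value there serves for both bounds. Negative
  \<open>x\<close> is reduced to the positive case by reflection.\<close>

lemma deriv_exp_decay_interpolation:
  fixes f :: "real \<Rightarrow> real"
  assumes f: "\<And>t. (f has_real_derivative f' t) (at t)"
    and f': "\<And>t. (f' has_real_derivative f'' t) (at t)"
    and "\<beta> \<ge> 0" "A \<ge> 0" "B \<ge> 0"
    and A: "\<And>t. \<bar>f t\<bar> \<le> A * exp (- \<beta> * \<bar>t\<bar>)"
    and B: "\<And>t. \<bar>f'' t\<bar> \<le> B * exp (- \<beta> * \<bar>t\<bar>)"
  shows "\<bar>f' x\<bar> \<le> (2 * A + B) * exp (- \<beta> * \<bar>x\<bar>)"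
proof -
  have mono: "A * exp (- \<beta> * \<bar>t\<bar>) \<le> A * exp (- \<beta> * \<bar>x\<bar>)" if "\<bar>t\<bar> \<ge> \<bar>x\<bar>" "A \<ge> 0" for t A
    using that \<open>\<beta> \<ge> 0\<close> by (intro mult_left_mono) (auto intro: mult_left_mono)
  have key: "\<bar>f t\<bar> \<le> A * exp (- \<beta> * \<bar>x\<bar>)" "\<bar>f'' t\<bar> \<le> B * exp (- \<beta> * \<bar>x\<bar>)" if "\<bar>t\<bar> \<ge> \<bar>x\<bar>" for t
    using A[of t] B[of t] mono[OF that] assms(4,5) by (meson order_trans)+
  show ?thesis
  proof (cases "x \<ge> 0")
    case True
    have "\<bar>f' x\<bar> \<le> 2 * (A * exp (- \<beta> * \<bar>x\<bar>)) + B * exp (- \<beta> * \<bar>x\<bar>)"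
      using True key by (intro deriv_bound_interpolation[OF f f']) auto
    then show ?thesis by (simp add: algebra_simps)
  next
    case False
    have "\<bar>- f' (- (- x))\<bar> \<le> 2 * (A * exp (- \<beta> * \<bar>x\<bar>)) + B * exp (- \<beta> * \<bar>x\<bar>)"
    proof (rule deriv_bound_interpolation[where f = "\<lambda>t. f (- t)" and f' = "\<lambda>t. - f' (- t)"
          and f'' = "\<lambda>t. f'' (- t)"])
      show "((\<lambda>t. f (- t)) has_real_derivative - f' (- t)) (at t)" for t
        using f[of "- t"] by (simp add: DERIV_mirror)
      show "((\<lambda>t. - f' (- t)) has_real_derivative f'' (- t)) (at t)" for t
        using DERIV_minus[OF f'[of "- t", unfolded DERIV_mirror]] by simp
    qed (use False key in auto)
    then show ?thesis by (simp add: algebra_simps)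
  qed
qed

text \<open>Meant for second-order equations: the equation bounds \<open>f''\<close> through order
  \<open>k\<close>, interpolation fills the gap at order one, and two orders are gained at
  once.\<close>

lemma bounded_derivs_interpolation:
  assumes f: "\<And>s t. s \<in> S \<Longrightarrow> (f s has_real_derivative f' s t) (at t)"
    and f': "\<And>s t. s \<in> S \<Longrightarrow> (f' s has_real_derivative f'' s t) (at t)"
    and "\<beta> \<ge> 0" and a: "\<And>s. s \<in> S \<Longrightarrow> a s \<ge> 0"
    and A: "bounded_derivs S (\<lambda>s x. a s * exp (- \<beta> * \<bar>x\<bar>)) 0 f"
    and B: "bounded_derivs S (\<lambda>s x. a s * exp (- \<beta> * \<bar>x\<bar>)) k f''"
  shows "bounded_derivs S (\<lambda>s x. a s * exp (- \<beta> * \<bar>x\<bar>)) (Suc (Suc k)) f"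
proof -
  obtain A where A': "A > 0" "\<And>s x. s \<in> S \<Longrightarrow> a s * exp (- \<beta> * \<bar>x\<bar>) \<ge> 0 \<Longrightarrow> \<bar>f s x\<bar> \<le> A * (a s * exp (- \<beta> * \<bar>x\<bar>))"
    using bounded_derivs_bound[OF A] by metis
  obtain B where B': "B > 0" "\<And>s x. s \<in> S \<Longrightarrow> a s * exp (- \<beta> * \<bar>x\<bar>) \<ge> 0 \<Longrightarrow> \<bar>f'' s x\<bar> \<le> B * (a s * exp (- \<beta> * \<bar>x\<bar>))"
    using bounded_derivs_bound[OF B] by metis
  have "\<bar>f' s x\<bar> \<le> (2 * A + B) * (a s * exp (- \<beta> * \<bar>x\<bar>))" if "s \<in> S" for s x
  proof -
    have "\<bar>f' s x\<bar> \<le> (2 * (A * a s) + B * a s) * exp (- \<beta> * \<bar>x\<bar>)"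
      using that f f' a[OF that] \<open>\<beta> \<ge> 0\<close> A' B'
      by (intro deriv_exp_decay_interpolation[of "f s" "f' s" "f'' s"]) (auto simp: mult.assoc)
    then show ?thesis by (simp add: algebra_simps)
  qed
  then have "bounded_derivs S (\<lambda>s x. a s * exp (- \<beta> * \<bar>x\<bar>)) 0 f'" by auto
  then show ?thesis
    using A B f f' by (intro bounded_derivs_SucI[where f = f and f' = f']
        bounded_derivs_SucI[where f = f' and f' = f'']) auto
qed

section \<open>Comparison with the linear equation for the reciprocal profile\<close>

text \<open>The operator factors as (D - k) (D + k). First \<open>f' + k * f\<close> is shown
  nonnegative, because its product with \<open>exp (- k * x)\<close> is nondecreasing; then the same
  is done for \<open>f\<close> with \<open>exp (k * x)\<close>.\<close>

lemma second_order_comparison: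
  fixes f :: "real \<Rightarrow> real"
  assumes f: "\<And>x. (f has_real_derivative f' x) (at x)"
    and f': "\<And>x. (f' has_real_derivative f'' x) (at x)"
    and ineq: "\<And>x. x \<ge> 0 \<Longrightarrow> k\<^sup>2 * f x \<le> f'' x"
    and "f 0 \<ge> 0" "f' 0 \<ge> 0" "k \<ge> 0" "x \<ge> 0"
  shows "f x \<ge> 0"
proof -
  have p: "f' x + k * f x \<ge> 0" if "x \<ge> 0" for x
  proof -
    have "(f' 0 + k * f 0) * exp (- k * 0) \<le> (f' x + k * f x) * exp (- k * x)"
    proof (rule DERIV_nonneg_imp_nondecreasing[OF that])
      fix t :: real assume "0 \<le> t" "t \<le> x"
      have "((\<lambda>x. (f' x + k * f x) * exp (- k * x)) has_real_derivative
          (f'' t - k\<^sup>2 * f t) * exp (- k * t)) (at t)"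
        by (auto intro!: derivative_eq_intros f f' simp: algebra_simps power2_eq_square)
      moreover have "0 \<le> (f'' t - k\<^sup>2 * f t) * exp (- k * t)" using ineq[OF \<open>0 \<le> t\<close>] by simp
      ultimately show "\<exists>y. ((\<lambda>x. (f' x + k * f x) * exp (- k * x)) has_real_derivative y) (at t) \<and> 0 \<le> y"
        by blast
    qed
    moreover have "0 \<le> f' 0 + k * f 0" using assms by auto
    ultimately have "0 \<le> (f' x + k * f x) * exp (- k * x)" by simp
    then show ?thesis by (simp add: zero_le_mult_iff)
  qed
  have "f 0 * exp (k * 0) \<le> f x * exp (k * x)"
  proof (rule DERIV_nonneg_imp_nondecreasing[OF \<open>x \<ge> 0\<close>])
    fix t :: real assume "0 \<le> t" "t \<le> x"
    have "((\<lambda>x. f x * exp (k * x)) has_real_derivative (f' t + k * f t) * exp (k * t)) (at t)"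
      by (auto intro!: derivative_eq_intros f simp: algebra_simps)
    moreover have "0 \<le> (f' t + k * f t) * exp (k * t)" using p[OF \<open>0 \<le> t\<close>] by simp
    ultimately show "\<exists>y. ((\<lambda>x. f x * exp (k * x)) has_real_derivative y) (at t) \<and> 0 \<le> y"
      by blast
  qed
  then have "0 \<le> f x * exp (k * x)" using \<open>f 0 \<ge> 0\<close> by simp
  then show ?thesis by (simp add: zero_le_mult_iff)
qed

lemma cosh_exp_bounds:
  fixes x :: real
  assumes "x \<ge> 0"
  shows "exp x / 2 \<le> cosh x" "cosh x \<le> exp x"
  using assms unfolding cosh_def by auto

lemma cosh_has_derivs:
  fixes k :: real
  shows "((\<lambda>x. cosh (k * x)) has_real_derivative k * sinh (k * x)) (at x)"
    "((\<lambda>x. k * sinh (k * x)) has_real_derivative k\<^sup>2 * cosh (k * x)) (at x)"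
  by (auto intro!: derivative_eq_intros simp: power2_eq_square)

text \<open>For \<open>e = 0\<close> and \<open>y 0 = 2 * b / \<kappa>\<^sup>2\<close> the solution
  is \<open>b / \<kappa>\<^sup>2 * (1 + cosh (\<kappa> * x))\<close>. The slack 7/16 is 1 - (3/4)^2
  and lies below (5/4)^2 - 1 = 9/16, so the perturbed equation stays between the rates 3/4 \<kappa>
  and 5/4 \<kappa>, and hyperbolic cosines with these rates serve as barriers.\<close>

lemma reciprocal_profile_estimate:
  fixes y :: "real \<Rightarrow> real"
  assumes y: "\<And>x. (y has_real_derivative y' x) (at x)"
    and y': "\<And>x. (y' has_real_derivative y'' x) (at x)"
    and ode: "\<And>x. x \<ge> 0 \<Longrightarrow> \<bar>y'' x - (\<kappa>\<^sup>2 * y x - b)\<bar> \<le> e * y x"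
    and pos: "\<And>x. y x > 0" and y'0: "y' 0 = 0"
    and "\<kappa> > 0" "b > 0" "e \<ge> 0" and e: "e \<le> 7/16 * \<kappa>\<^sup>2"
    and y0: "\<bar>y 0 - 2 * b / \<kappa>\<^sup>2\<bar> \<le> e0" and e0: "e0 \<le> b / \<kappa>\<^sup>2 / 9"
    and M: "e0 \<le> M" "16/3 * e * b / \<kappa>\<^sup>2 \<le> M * \<kappa>\<^sup>2" and "x \<ge> 0"
  shows "b / \<kappa>\<^sup>2 / 18 * exp (3/4 * \<kappa> * x) \<le> y x"
    and "\<bar>y x - b / \<kappa>\<^sup>2 * (1 + cosh (\<kappa> * x))\<bar> \<le> M * exp (5/4 * \<kappa> * x)"
proof -
  have \<kappa>2: "\<kappa>\<^sup>2 > 0" using \<open>\<kappa> > 0\<close> by simp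
  define \<eta> where "\<eta> = b / \<kappa>\<^sup>2"
  have \<eta>: "\<eta> > 0" "b = \<eta> * \<kappa>\<^sup>2" using \<open>b > 0\<close> \<open>\<kappa> > 0\<close> by (auto simp: \<eta>_def)
  have y0b: "y 0 \<le> 3 * \<eta>" "17/9 * \<eta> \<le> y 0"
    using y0 e0 \<eta>(1) by (auto simp: \<eta>_def abs_le_iff)
  have e0': "e0 \<ge> 0" using y0 by linarith
  \<comment> \<open>A crude growth bound, needed to estimate the perturbation \<open>e * y\<close>
    when the error is compared below.\<close>
  have upper: "y x \<le> y 0 * cosh (5/4 * \<kappa> * x)" if "x \<ge> 0" for x
  proof -
    have "0 \<le> y 0 * cosh (5/4 * \<kappa> * x) - y x"
    proof (rule second_order_comparison[where k = "5/4 * \<kappa>" and x = x])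
      show "((\<lambda>x. y 0 * cosh (5/4 * \<kappa> * x) - y x) has_real_derivative
          y 0 * (5/4 * \<kappa> * sinh (5/4 * \<kappa> * x)) - y' x) (at x)" for x
        by (intro derivative_intros cosh_has_derivs y DERIV_cmult)
      show "((\<lambda>x. y 0 * (5/4 * \<kappa> * sinh (5/4 * \<kappa> * x)) - y' x) has_real_derivative
          y 0 * ((5/4 * \<kappa>)\<^sup>2 * cosh (5/4 * \<kappa> * x)) - y'' x) (at x)" for x
        by (intro derivative_intros cosh_has_derivs y' DERIV_cmult)
      fix t :: real assume "t \<ge> 0"
      have "y'' t \<le> (\<kappa>\<^sup>2 + e) * y t - b"
        using ode[OF \<open>t \<ge> 0\<close>] by (simp add: abs_le_iff algebra_simps)
      also have "\<dots> \<le> (5/4 * \<kappa>)\<^sup>2 * y t"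
      proof -
        have "\<kappa>\<^sup>2 + e \<le> (5/4)\<^sup>2 * \<kappa>\<^sup>2"
          using e \<kappa>2 unfolding power2_eq_square[of "5/4"] by linarith
        then have "\<kappa>\<^sup>2 + e \<le> (5/4 * \<kappa>)\<^sup>2" by (simp only: power_mult_distrib)
        then have "(\<kappa>\<^sup>2 + e) * y t \<le> (5/4 * \<kappa>)\<^sup>2 * y t"
          using pos[of t] by (intro mult_right_mono) auto
        then show ?thesis using \<open>b > 0\<close> by simp
      qed
      finally show "(5/4 * \<kappa>)\<^sup>2 * (y 0 * cosh (5/4 * \<kappa> * t) - y t)
          \<le> y 0 * ((5/4 * \<kappa>)\<^sup>2 * cosh (5/4 * \<kappa> * t)) - y'' t"
        by (simp add: algebra_simps)
    qed (use y'0 \<open>\<kappa> > 0\<close> that in auto)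
    then show ?thesis by simp
  qed
  \<comment> \<open>This is \<open>b / (3/4 * \<kappa>)\<^sup>2\<close>, the equilibrium of the
    equation with the slower rate. Since \<open>y 0\<close> is at least 17/9 \<eta>, it exceeds
    \<open>p\<close> by at least \<eta>/9, which is the amplitude available for the growing
    barrier.\<close>
  define p where "p = 16/9 * \<eta>"
  have "0 \<le> y x - p - \<eta> / 9 * cosh (3/4 * \<kappa> * x)"
  proof (rule second_order_comparison[where k = "3/4 * \<kappa>" and x = x])
    show "((\<lambda>x. y x - p - \<eta> / 9 * cosh (3/4 * \<kappa> * x)) has_real_derivative
        y' x - \<eta> / 9 * (3/4 * \<kappa> * sinh (3/4 * \<kappa> * x))) (at x)" for x
      using cosh_has_derivs(1)[of "3/4 * \<kappa>" x]
      by (auto intro!: derivative_eq_intros y DERIV_cmult)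
    show "((\<lambda>x. y' x - \<eta> / 9 * (3/4 * \<kappa> * sinh (3/4 * \<kappa> * x))) has_real_derivative
        y'' x - \<eta> / 9 * ((3/4 * \<kappa>)\<^sup>2 * cosh (3/4 * \<kappa> * x))) (at x)" for x
      by (intro derivative_intros cosh_has_derivs y' DERIV_cmult)
    fix t :: real assume "t \<ge> 0"
    have "(3/4 * \<kappa>)\<^sup>2 * y t \<le> (\<kappa>\<^sup>2 - e) * y t"
      using e pos[of t] by (intro mult_right_mono) (auto simp: power_mult_distrib power_divide)
    moreover have "(\<kappa>\<^sup>2 - e) * y t - b \<le> y'' t"
      using ode[OF \<open>t \<ge> 0\<close>] by (simp add: abs_le_iff algebra_simps)
    moreover have "(3/4 * \<kappa>)\<^sup>2 * p = b" by (simp add: \<eta>(2) p_def power_mult_distrib power2_eq_square)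
    ultimately show "(3/4 * \<kappa>)\<^sup>2 * (y t - p - \<eta> / 9 * cosh (3/4 * \<kappa> * t))
        \<le> y'' t - \<eta> / 9 * ((3/4 * \<kappa>)\<^sup>2 * cosh (3/4 * \<kappa> * t))"
      by (simp add: algebra_simps)
  qed (use y'0 y0b \<open>\<kappa> > 0\<close> \<open>x \<ge> 0\<close> in \<open>auto simp: p_def\<close>)
  moreover have "\<eta> / 9 * (exp (3/4 * \<kappa> * x) / 2) \<le> \<eta> / 9 * cosh (3/4 * \<kappa> * x)"
    using \<eta> \<open>\<kappa> > 0\<close> \<open>x \<ge> 0\<close> by (intro mult_left_mono cosh_exp_bounds) auto
  ultimately show "b / \<kappa>\<^sup>2 / 18 * exp (3/4 * \<kappa> * x) \<le> y x"
    using \<eta>(1) unfolding \<eta>_def[symmetric] p_def by argo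

  \<comment> \<open>The signs \<open>c = 1\<close> and \<open>c = -1\<close> give the two halves of
    the absolute value. The barrier has a surplus of ((5/4)^2 - 1) \<kappa>^2 = 9/16 \<kappa>^2 over
    the rate \<kappa>, and this must absorb \<open>e * y\<close>, at most 3 e \<eta> times the same
    cosh; hence the 16/3 in \<open>M(2)\<close>.\<close>
  have diff: "0 \<le> M * cosh (5/4 * \<kappa> * x) + c * (y x - \<eta> - \<eta> * cosh (\<kappa> * x))" if c: "\<bar>c\<bar> = 1" for c
  proof (rule second_order_comparison[where k = \<kappa> and x = x])
    show "((\<lambda>x. M * cosh (5/4 * \<kappa> * x) + c * (y x - \<eta> - \<eta> * cosh (\<kappa> * x))) has_real_derivative
        M * (5/4 * \<kappa> * sinh (5/4 * \<kappa> * x)) + c * (y' x - 0 - \<eta> * (\<kappa> * sinh (\<kappa> * x)))) (at x)" for x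
      by (intro derivative_intros cosh_has_derivs y DERIV_cmult)
    show "((\<lambda>x. M * (5/4 * \<kappa> * sinh (5/4 * \<kappa> * x)) + c * (y' x - 0 - \<eta> * (\<kappa> * sinh (\<kappa> * x)))) has_real_derivative
        M * ((5/4 * \<kappa>)\<^sup>2 * cosh (5/4 * \<kappa> * x)) + c * (y'' x - 0 - \<eta> * (\<kappa>\<^sup>2 * cosh (\<kappa> * x)))) (at x)" for x
      by (intro derivative_intros cosh_has_derivs y' DERIV_cmult)
    have "\<bar>c * (y 0 - 2 * \<eta>)\<bar> \<le> M"
      using y0 M c by (simp add: abs_mult \<eta>_def)
    then show "0 \<le> M * cosh (5/4 * \<kappa> * 0) + c * (y 0 - \<eta> - \<eta> * cosh (\<kappa> * 0))"
      by (simp add: abs_le_iff algebra_simps)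
    fix t :: real assume "t \<ge> 0"
    define s where "s = y'' t - (\<kappa>\<^sup>2 * y t - b)"
    have "\<bar>c * s\<bar> \<le> e * y t"
      using ode[OF \<open>t \<ge> 0\<close>] c by (simp add: abs_mult s_def)
    also have "\<dots> \<le> e * (3 * \<eta> * cosh (5/4 * \<kappa> * t))"
    proof -
      have "y 0 * cosh (5/4 * \<kappa> * t) \<le> 3 * \<eta> * cosh (5/4 * \<kappa> * t)"
        using y0b by (intro mult_right_mono) auto
      then have "y t \<le> 3 * \<eta> * cosh (5/4 * \<kappa> * t)" using upper[OF \<open>t \<ge> 0\<close>] by (rule order_trans[rotated])
      then show ?thesis using \<open>e \<ge> 0\<close> by (rule mult_left_mono)
    qed
    also have "\<dots> = (3 * e * \<eta>) * cosh (5/4 * \<kappa> * t)" by simp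
    also have "\<dots> \<le> (9/16 * M * \<kappa>\<^sup>2) * cosh (5/4 * \<kappa> * t)"
    proof (intro mult_right_mono)
      have "16/3 * (e * \<eta>) \<le> M * \<kappa>\<^sup>2" using M(2) by (simp add: \<eta>_def)
      then show "3 * e * \<eta> \<le> 9/16 * M * \<kappa>\<^sup>2" by (simp add: algebra_simps)
    qed auto
    finally have "- (c * s) \<le> (9/16 * M * \<kappa>\<^sup>2) * cosh (5/4 * \<kappa> * t)" by linarith
    then show "\<kappa>\<^sup>2 * (M * cosh (5/4 * \<kappa> * t) + c * (y t - \<eta> - \<eta> * cosh (\<kappa> * t)))
        \<le> M * ((5/4 * \<kappa>)\<^sup>2 * cosh (5/4 * \<kappa> * t)) + c * (y'' t - 0 - \<eta> * (\<kappa>\<^sup>2 * cosh (\<kappa> * t)))"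
      by (simp add: s_def \<eta>(2) algebra_simps power2_eq_square)
  qed (use y'0 \<open>\<kappa> > 0\<close> \<open>x \<ge> 0\<close> in auto)
  have "\<bar>y x - \<eta> * (1 + cosh (\<kappa> * x))\<bar> \<le> M * cosh (5/4 * \<kappa> * x)"
    using diff[of 1] diff[of "-1"] by (auto simp: abs_le_iff algebra_simps)
  also have "\<dots> \<le> M * exp (5/4 * \<kappa> * x)"
    using M(1) e0' \<open>\<kappa> > 0\<close> \<open>x \<ge> 0\<close> by (intro mult_left_mono cosh_exp_bounds) auto
  finally show "\<bar>y x - b / \<kappa>\<^sup>2 * (1 + cosh (\<kappa> * x))\<bar> \<le> M * exp (5/4 * \<kappa> * x)"
    by (simp add: \<eta>_def)
qed


lemma reciprocal_ode:
  fixes \<psi> :: "real \<Rightarrow> real"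
  assumes \<psi>: "\<And>x. (\<psi> has_real_derivative \<psi>' x) (at x)"
    and \<psi>': "\<And>x. (\<psi>' has_real_derivative \<psi>'' x) (at x)"
    and pos: "\<And>x. \<psi> x > 0"
  shows "((\<lambda>x. 1 / \<psi> x) has_real_derivative - \<psi>' x / (\<psi> x)\<^sup>2) (at x)"
    "((\<lambda>x. - \<psi>' x / (\<psi> x)\<^sup>2) has_real_derivative
      2 * (\<psi>' x)\<^sup>2 / (\<psi> x) ^ 3 - \<psi>'' x / (\<psi> x)\<^sup>2) (at x)"
proof -
  have nz: "\<psi> x \<noteq> 0" using pos[of x] by simp
  show "((\<lambda>x. 1 / \<psi> x) has_real_derivative - \<psi>' x / (\<psi> x)\<^sup>2) (at x)"
    using nz by (auto intro!: derivative_eq_intros \<psi> simp: power2_eq_square)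
  show "((\<lambda>x. - \<psi>' x / (\<psi> x)\<^sup>2) has_real_derivative
      2 * (\<psi>' x)\<^sup>2 / (\<psi> x) ^ 3 - \<psi>'' x / (\<psi> x)\<^sup>2) (at x)"
    using nz by (auto intro!: derivative_eq_intros \<psi> \<psi>'
        simp: divide_simps power2_eq_square power3_eq_cube) (simp add: algebra_simps)
qed

lemma profile_estimate:
  fixes V \<gamma> C0 :: real
  assumes "V > 0" "\<gamma> > 0" "C0 > 0"
  defines "\<kappa> \<equiv> sqrt (2 * V * \<gamma>)"
  obtains \<epsilon>1 C where "\<epsilon>1 > 0" "C > 0"
    "\<And>\<epsilon> \<psi> \<psi>' \<psi>'' x. \<lbrakk>0 < \<epsilon>; \<epsilon> < \<epsilon>1;
      \<And>x. (\<psi> has_real_derivative \<psi>' x) (at x);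
      \<And>x. (\<psi>' has_real_derivative \<psi>'' x) (at x);
      \<And>x. \<psi> x > 0; \<psi>' 0 = 0; \<bar>\<psi> 0 - 3 * \<gamma> / V\<bar> \<le> C0 * \<epsilon>;
      \<And>x. x \<ge> 0 \<Longrightarrow> \<bar>\<psi>'' x - (\<kappa>\<^sup>2 * \<psi> x - V\<^sup>2 * (\<psi> x)\<^sup>2)\<bar> \<le> C0 * \<epsilon> * \<psi> x;
      \<And>x. x \<ge> 0 \<Longrightarrow> \<bar>(\<psi>' x)\<^sup>2 - (\<kappa>\<^sup>2 * (\<psi> x)\<^sup>2 - 2/3 * V\<^sup>2 * (\<psi> x) ^ 3)\<bar> \<le> C0 * \<epsilon> * (\<psi> x)\<^sup>2;
      x \<ge> 0\<rbrakk> \<Longrightarrow> \<psi> x \<le> C * exp (- (\<kappa> / 2) * x) \<and>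
        \<bar>\<psi> x - 6 * \<gamma> / V / (1 + cosh (\<kappa> * x))\<bar> \<le> C * (\<epsilon> * exp (- (\<kappa> / 2) * x))"
proof -
  have \<kappa>2: "\<kappa>\<^sup>2 = 2 * V * \<gamma>" and \<kappa>: "\<kappa> > 0" using assms by (auto simp: \<kappa>_def)
  define b where "b = V\<^sup>2 / 3"
  define \<eta> where "\<eta> = V / (6 * \<gamma>)"
  have \<eta>: "b / \<kappa>\<^sup>2 = \<eta>" "\<eta> > 0" "b > 0"
    using assms by (auto simp: \<kappa>2 b_def \<eta>_def power2_eq_square)
  define D0 where "D0 = C0 * V\<^sup>2 / (6 * \<gamma>\<^sup>2)"
  \<comment> \<open>The sum dominates both lower bounds that the reciprocal estimate imposes on
    \<open>M\<close>, taken with \<open>e = 3 * C0 * \<epsilon>\<close> and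
    \<open>e0 = D0 * \<epsilon>\<close>.\<close>
  define M0 where "M0 = D0 + 16 * C0 * \<eta> / \<kappa>\<^sup>2"
  have D0: "D0 > 0" and M0: "M0 > 0" using assms \<eta> \<kappa> by (auto simp: D0_def M0_def intro!: add_pos_nonneg)
  \<comment> \<open>The three bounds secure in turn that \<psi>(0) is at least 2 \<gamma>/V, that
    the perturbation stays within the slack 7/16 \<kappa>^2, and that the initial error is at most
    \<eta>/9.\<close>
  define \<epsilon>1 where "\<epsilon>1 = min (\<gamma> / V / C0) (min (7/16 * \<kappa>\<^sup>2 / (3 * C0)) (\<eta> / 9 / D0))"
  define C where "C = 18 / \<eta> + 18 / \<eta> * (2 / \<eta>) * M0"
  show ?thesis
  proof
    show "\<epsilon>1 > 0" using assms \<eta> \<kappa> D0 by (simp add: \<epsilon>1_def)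
    show "C > 0" unfolding C_def using \<eta>(2) M0 by (intro add_pos_pos mult_pos_pos divide_pos_pos) auto
    fix \<epsilon> :: real and \<psi> \<psi>' \<psi>'' :: "real \<Rightarrow> real" and x :: real
    assume \<epsilon>: "0 < \<epsilon>" "\<epsilon> < \<epsilon>1"
      and \<psi>: "\<And>x. (\<psi> has_real_derivative \<psi>' x) (at x)"
      and \<psi>': "\<And>x. (\<psi>' has_real_derivative \<psi>'' x) (at x)"
      and pos: "\<And>x. \<psi> x > 0" and "\<psi>' 0 = 0" and init: "\<bar>\<psi> 0 - 3 * \<gamma> / V\<bar> \<le> C0 * \<epsilon>"
      and ode: "\<And>x. x \<ge> 0 \<Longrightarrow> \<bar>\<psi>'' x - (\<kappa>\<^sup>2 * \<psi> x - V\<^sup>2 * (\<psi> x)\<^sup>2)\<bar> \<le> C0 * \<epsilon> * \<psi> x"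
      and energy: "\<And>x. x \<ge> 0 \<Longrightarrow> \<bar>(\<psi>' x)\<^sup>2 - (\<kappa>\<^sup>2 * (\<psi> x)\<^sup>2 - 2/3 * V\<^sup>2 * (\<psi> x) ^ 3)\<bar> \<le> C0 * \<epsilon> * (\<psi> x)\<^sup>2"
      and "x \<ge> 0"
    have small: "C0 * \<epsilon> \<le> \<gamma> / V" "3 * C0 * \<epsilon> \<le> 7/16 * \<kappa>\<^sup>2" "D0 * \<epsilon> \<le> \<eta> / 9"
    proof -
      have "\<epsilon> \<le> \<gamma> / V / C0" "\<epsilon> \<le> 7/16 * \<kappa>\<^sup>2 / (3 * C0)" "\<epsilon> \<le> \<eta> / 9 / D0"
        using \<epsilon>(2) by (auto simp: \<epsilon>1_def)
      then show "C0 * \<epsilon> \<le> \<gamma> / V" "3 * C0 * \<epsilon> \<le> 7/16 * \<kappa>\<^sup>2" "D0 * \<epsilon> \<le> \<eta> / 9"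
        using \<open>C0 > 0\<close> D0 by (simp_all only: pos_le_divide_eq mult_ac)
    qed
    define y where "y = (\<lambda>x. 1 / \<psi> x)"
    have ypos: "y x > 0" for x using pos by (simp add: y_def)
    \<comment> \<open>Without errors, y'' = 2 (\<kappa>^2 y - 2/3 V^2) - (\<kappa>^2 y - V^2) =
      \<kappa>^2 y - V^2/3: the energy removes the square of the first derivative and the equation
      becomes linear. The error of the energy counts twice and that of the equation once, hence the
      factor 3.\<close>
    have y_ode: "\<bar>(2 * (\<psi>' t)\<^sup>2 / (\<psi> t) ^ 3 - \<psi>'' t / (\<psi> t)\<^sup>2) - (\<kappa>\<^sup>2 * y t - b)\<bar> \<le> (3 * C0 * \<epsilon>) * y t"
      if "t \<ge> 0" for t
    proof -
      define p where "p = \<psi> t"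
      have p: "p > 0" using pos by (simp add: p_def)
      define r1 r2 where "r1 = \<psi>'' t - (\<kappa>\<^sup>2 * p - V\<^sup>2 * p\<^sup>2)"
        and "r2 = (\<psi>' t)\<^sup>2 - (\<kappa>\<^sup>2 * p\<^sup>2 - 2/3 * V\<^sup>2 * p ^ 3)"
      have eqs: "\<psi>'' t = \<kappa>\<^sup>2 * p - V\<^sup>2 * p\<^sup>2 + r1" "(\<psi>' t)\<^sup>2 = \<kappa>\<^sup>2 * p\<^sup>2 - 2/3 * V\<^sup>2 * p ^ 3 + r2"
        by (auto simp: r1_def r2_def)
      have r: "\<bar>r1\<bar> \<le> C0 * \<epsilon> * p" "\<bar>r2\<bar> \<le> C0 * \<epsilon> * p\<^sup>2"
        using ode[OF that] energy[OF that] by (auto simp: r1_def r2_def p_def)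
      have "(2 * (\<psi>' t)\<^sup>2 / (\<psi> t) ^ 3 - \<psi>'' t / (\<psi> t)\<^sup>2) - (\<kappa>\<^sup>2 * y t - b) = (2 * p * r2 - p\<^sup>2 * r1) / p ^ 4"
        unfolding eqs using p
        by (simp add: p_def[symmetric] y_def b_def divide_simps) (simp add: algebra_simps eval_nat_numeral)
      also have "\<bar>\<dots>\<bar> \<le> (2 * p * (C0 * \<epsilon> * p\<^sup>2) + p\<^sup>2 * (C0 * \<epsilon> * p)) / p ^ 4"
      proof -
        have "\<bar>2 * p * r2\<bar> \<le> 2 * p * (C0 * \<epsilon> * p\<^sup>2)" "\<bar>p\<^sup>2 * r1\<bar> \<le> p\<^sup>2 * (C0 * \<epsilon> * p)"
          using r p by (simp_all add: abs_mult)
        then have "\<bar>2 * p * r2 - p\<^sup>2 * r1\<bar> \<le> 2 * p * (C0 * \<epsilon> * p\<^sup>2) + p\<^sup>2 * (C0 * \<epsilon> * p)" by linarith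
        then show ?thesis using p by (simp add: divide_right_mono)
      qed
      also have "\<dots> = 3 * C0 * \<epsilon> * y t"
        using p by (simp add: y_def p_def[symmetric] divide_simps) (simp add: algebra_simps eval_nat_numeral)
      finally show ?thesis .
    qed
    have y_init: "\<bar>y 0 - 2 * b / \<kappa>\<^sup>2\<bar> \<le> D0 * \<epsilon>"
    proof -
      have \<psi>0: "\<psi> 0 \<ge> 2 * \<gamma> / V" using init small(1) by (simp add: abs_le_iff)
      have "y 0 - 2 * b / \<kappa>\<^sup>2 = - (\<psi> 0 - 3 * \<gamma> / V) * (V / (3 * \<gamma>)) / \<psi> 0"
        using pos[of 0] assms \<eta>(1) by (simp add: y_def \<eta>_def field_simps)
      then have "\<bar>y 0 - 2 * b / \<kappa>\<^sup>2\<bar> = \<bar>\<psi> 0 - 3 * \<gamma> / V\<bar> * (V / (3 * \<gamma>)) / \<psi> 0"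
        using pos[of 0] assms by (simp add: abs_mult)
      also have "\<dots> \<le> (C0 * \<epsilon>) * (V / (3 * \<gamma>)) / (2 * \<gamma> / V)"
        using init \<psi>0 assms by (intro frac_le mult_right_mono) (auto intro!: mult_nonneg_nonneg order_trans[OF abs_ge_zero init])
      also have "\<dots> = D0 * \<epsilon>" by (simp add: D0_def power2_eq_square)
      finally show ?thesis .
    qed
    have y'0: "- \<psi>' 0 / (\<psi> 0)\<^sup>2 = 0" using \<open>\<psi>' 0 = 0\<close> by simp
    note est = reciprocal_profile_estimate[where y = y and b = b and \<kappa> = \<kappa> and e = "3 * C0 * \<epsilon>"
        and e0 = "D0 * \<epsilon>" and M = "M0 * \<epsilon>", OF reciprocal_ode[OF \<psi> \<psi>' pos, folded y_def] y_ode ypos y'0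
        \<kappa> \<open>b > 0\<close> _ small(2) y_init _ _ _ \<open>x \<ge> 0\<close>]
    have side: "0 \<le> 3 * C0 * \<epsilon>" "D0 * \<epsilon> \<le> b / \<kappa>\<^sup>2 / 9" "D0 * \<epsilon> \<le> M0 * \<epsilon>"
      "16/3 * (3 * C0 * \<epsilon>) * b / \<kappa>\<^sup>2 \<le> M0 * \<epsilon> * \<kappa>\<^sup>2"
    proof -
      show "0 \<le> 3 * C0 * \<epsilon>" "D0 * \<epsilon> \<le> b / \<kappa>\<^sup>2 / 9" using assms \<epsilon> small(3) \<eta>(1) by auto
      have nn: "16 * C0 * \<eta> / \<kappa>\<^sup>2 \<ge> 0" using assms \<eta> by auto
      then show "D0 * \<epsilon> \<le> M0 * \<epsilon>" using \<epsilon> by (simp add: M0_def)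
      have "16/3 * (3 * C0 * \<epsilon>) * b / \<kappa>\<^sup>2 = (16 * C0 * \<eta> / \<kappa>\<^sup>2) * \<epsilon> * \<kappa>\<^sup>2"
        using \<kappa> by (simp flip: \<eta>(1) add: field_simps eval_nat_numeral)
      also have "\<dots> \<le> M0 * \<epsilon> * \<kappa>\<^sup>2"
        using D0 \<epsilon> by (intro mult_right_mono) (auto simp: M0_def)
      finally show "16/3 * (3 * C0 * \<epsilon>) * b / \<kappa>\<^sup>2 \<le> M0 * \<epsilon> * \<kappa>\<^sup>2" .
    qed
    have low: "\<eta> / 18 * exp (3/4 * \<kappa> * x) \<le> y x"
      and diff: "\<bar>y x - \<eta> * (1 + cosh (\<kappa> * x))\<bar> \<le> M0 * \<epsilon> * exp (5/4 * \<kappa> * x)"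
      using est[OF _ side] by (simp_all only: \<eta>(1))
    define z where "z = \<eta> * (1 + cosh (\<kappa> * x))"
    have zlow: "\<eta> / 2 * exp (\<kappa> * x) \<le> z"
    proof -
      have "\<eta> * (exp (\<kappa> * x) / 2) \<le> \<eta> * (1 + cosh (\<kappa> * x))"
        using \<eta> cosh_exp_bounds(1)[of "\<kappa> * x"] \<kappa> \<open>x \<ge> 0\<close> by (intro mult_left_mono) auto
      then show ?thesis by (simp add: z_def)
    qed
    have zpos: "z > 0" by (rule less_le_trans[OF _ zlow]) (use \<eta>(2) in simp)
    have inv_bounds: "1 / y x \<le> 18 / \<eta> * exp (- (3/4 * \<kappa> * x))" "1 / z \<le> 2 / \<eta> * exp (- (\<kappa> * x))"
    proof -
      have "1 / y x \<le> 1 / (\<eta> / 18 * exp (3/4 * \<kappa> * x))"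
        using low \<eta> by (intro divide_left_mono) (auto intro!: mult_pos_pos ypos)
      then show "1 / y x \<le> 18 / \<eta> * exp (- (3/4 * \<kappa> * x))" by (simp add: exp_minus divide_simps)
      have "1 / z \<le> 1 / (\<eta> / 2 * exp (\<kappa> * x))"
        using zlow \<eta> zpos by (intro divide_left_mono) (auto intro!: mult_pos_pos)
      then show "1 / z \<le> 2 / \<eta> * exp (- (\<kappa> * x))" by (simp add: exp_minus divide_simps)
    qed
    have \<psi>y: "\<psi> x = 1 / y x" by (simp add: y_def)
    have "6 * \<gamma> / V / (1 + cosh (\<kappa> * x)) = 1 / z" using assms by (simp add: z_def \<eta>_def)
    have "\<psi> x \<le> 18 / \<eta> * exp (- (\<kappa> / 2) * x)"
    proof -
      have "exp (- (3/4 * \<kappa> * x)) \<le> exp (- (\<kappa> / 2) * x)"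
        using \<kappa> \<open>x \<ge> 0\<close> by simp
      then have "18 / \<eta> * exp (- (3/4 * \<kappa> * x)) \<le> 18 / \<eta> * exp (- (\<kappa> / 2) * x)"
        using \<eta> by (intro mult_left_mono) auto
      then show ?thesis using inv_bounds(1) \<psi>y by linarith
    qed
    also have "\<dots> \<le> C * exp (- (\<kappa> / 2) * x)"
      using \<eta> M0 by (intro mult_right_mono) (auto simp: C_def)
    finally have 1: "\<psi> x \<le> C * exp (- (\<kappa> / 2) * x)" .
    \<comment> \<open>The difference of the reciprocals grows at most at rate 5/4 \<kappa>, while
      \<open>1 / y x\<close> decays at rate 3/4 \<kappa> and \<open>1 / z\<close> at rate \<kappa>;
      what remains is the rate - \<kappa>/2.\<close>
    have "\<bar>\<psi> x - 1 / z\<bar> = \<bar>y x - z\<bar> * (1 / y x * (1 / z))"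
    proof -
      have "\<psi> x - 1 / z = - (y x - z) * (1 / y x * (1 / z))"
        using ypos[of x] zpos by (simp add: \<psi>y field_simps)
      then show ?thesis using ypos[of x] zpos by (simp add: abs_mult)
    qed
    also have "\<dots> \<le> (M0 * \<epsilon> * exp (5/4 * \<kappa> * x)) *
        (18 / \<eta> * exp (- (3/4 * \<kappa> * x)) * (2 / \<eta> * exp (- (\<kappa> * x))))"
      using inv_bounds diff ypos[of x] zpos \<eta> M0 \<epsilon> by (intro mult_mono) (auto simp: z_def)
    also have "\<dots> = (18 / \<eta> * (2 / \<eta>) * M0) * (\<epsilon> * (exp (5/4 * \<kappa> * x) * exp (- (3/4 * \<kappa> * x)) * exp (- (\<kappa> * x))))"
      by simp
    also have "exp (5/4 * \<kappa> * x) * exp (- (3/4 * \<kappa> * x)) * exp (- (\<kappa> * x)) = exp (- (\<kappa> / 2) * x)"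
      by (simp flip: exp_add)
    also have "(18 / \<eta> * (2 / \<eta>) * M0) * (\<epsilon> * exp (- (\<kappa> / 2) * x)) \<le> C * (\<epsilon> * exp (- (\<kappa> / 2) * x))"
      using \<epsilon> \<eta> by (intro mult_right_mono) (auto simp: C_def)
    finally have "\<bar>\<psi> x - 1 / z\<bar> \<le> C * (\<epsilon> * exp (- (\<kappa> / 2) * x))" .
    with 1 show "\<psi> x \<le> C * exp (- (\<kappa> / 2) * x) \<and>
        \<bar>\<psi> x - 6 * \<gamma> / V / (1 + cosh (\<kappa> * x))\<bar> \<le> C * (\<epsilon> * exp (- (\<kappa> / 2) * x))"
      using \<open>6 * \<gamma> / V / (1 + cosh (\<kappa> * x)) = 1 / z\<close> by simp
  qed
qed

section \<open>Expansion of the potential and of Poisson's equation\<close>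

lemma bounded_derivs_0_dominated:
  assumes "bounded_derivs S w 0 g" "\<And>s x. s \<in> S \<Longrightarrow> w s x \<ge> 0"
    and "\<And>s x. s \<in> S \<Longrightarrow> \<bar>f s x\<bar> \<le> K * \<bar>g s x\<bar>"
  shows "bounded_derivs S w 0 f"
proof -
  obtain C where C: "C > 0" "\<And>s x. s \<in> S \<Longrightarrow> w s x \<ge> 0 \<Longrightarrow> \<bar>g s x\<bar> \<le> C * w s x"
    using bounded_derivs_bound assms(1) by metis
  have "\<bar>f s x\<bar> \<le> (\<bar>K\<bar> * C) * w s x" if "s \<in> S" for s x
  proof -
    have "\<bar>f s x\<bar> \<le> K * \<bar>g s x\<bar>" using assms(3) that .
    also have "\<dots> \<le> \<bar>K\<bar> * (C * w s x)"
      using C(2)[OF that] assms(2)[OF that] by (intro mult_mono) auto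
    finally show ?thesis by (simp add: mult_ac)
  qed
  then show ?thesis by auto
qed

lemma bounded_derivs_weaken:
  assumes "bounded_derivs S w k f" "\<And>s x. s \<in> S \<Longrightarrow> 0 \<le> w s x \<and> w s x \<le> K"
  shows "bounded_derivs S (\<lambda>_ _. 1) k f"
  by (rule bounded_derivs_mono[OF assms(1), where K = K]) (use assms(2) in auto)

section \<open>Third-order Taylor remainders of the logarithm and the exponential\<close>

text \<open>The expression inside the absolute value has derivative t^2 / (1 + t), which lies
  between 0 and 3 t^2.\<close>

lemma ln_add_one_third_order:
  fixes x :: real
  assumes "x \<ge> 0"
  shows "\<bar>ln (1 + x) - x + x\<^sup>2 / 2\<bar> \<le> x ^ 3"
proof -
  define f where "f = (\<lambda>x::real. ln (1 + x) - x + x\<^sup>2 / 2)"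
  have f: "(f has_real_derivative t\<^sup>2 / (1 + t)) (at t)" if "t \<ge> 0" for t
    unfolding f_def using that
    by (auto intro!: derivative_eq_intros simp: divide_simps power2_eq_square algebra_simps)
  have "f 0 \<le> f x"
    by (rule DERIV_nonneg_imp_nondecreasing[OF assms]) (use f in \<open>fastforce intro: divide_nonneg_nonneg\<close>)
  moreover have "f x - x ^ 3 \<le> f 0 - 0 ^ 3"
  proof (rule DERIV_nonpos_imp_nonincreasing[OF assms])
    fix t :: real assume "0 \<le> t" "t \<le> x"
    have "((\<lambda>x. f x - x ^ 3) has_real_derivative t\<^sup>2 / (1 + t) - 3 * t\<^sup>2) (at t)"
      by (auto intro!: derivative_eq_intros f \<open>0 \<le> t\<close>)
    moreover have "t\<^sup>2 / (1 + t) \<le> t\<^sup>2 / 1" using \<open>0 \<le> t\<close> by (intro divide_left_mono) auto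
    then have "t\<^sup>2 / (1 + t) - 3 * t\<^sup>2 \<le> 0" using zero_le_power2[of t] by linarith
    ultimately show "\<exists>y. ((\<lambda>x. f x - x ^ 3) has_real_derivative y) (at t) \<and> y \<le> 0" by blast
  qed
  ultimately show ?thesis using assms by (simp add: f_def)
qed

lemma exp_third_order:
  fixes x :: real
  assumes "x \<ge> 0"
  shows "\<bar>exp x - 1 - x - x\<^sup>2 / 2\<bar> \<le> exp x * x ^ 3"
proof -
  obtain t where t: "\<bar>t\<bar> \<le> \<bar>x\<bar>" "exp x = (\<Sum>m<3. x ^ m / fact m) + exp t / fact 3 * x ^ 3"
    using Maclaurin_exp_le[of x 3] by blast
  have "exp x - 1 - x - x\<^sup>2 / 2 = exp t / 6 * x ^ 3"
    using t(2) by (simp add: eval_nat_numeral)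
  also have "\<bar>\<dots>\<bar> \<le> exp x * x ^ 3"
  proof -
    have "exp t \<le> exp x" using t(1) assms by auto
    then have "exp t / 6 \<le> exp x" using exp_gt_zero[of t] by linarith
    then have "exp t / 6 * x ^ 3 \<le> exp x * x ^ 3" using assms by (intro mult_right_mono) auto
    then show ?thesis using assms by (simp add: abs_mult)
  qed
  finally show ?thesis .
qed

text \<open>Division by \<open>\<epsilon> ^ 3\<close> compensates exactly the order of the Taylor
  remainder, so that the quotient stays bounded as \<epsilon> tends to 0. The same scaling is used
  for \<open>exp_remainder\<close>.\<close>

definition ln_remainder :: "real \<Rightarrow> real \<Rightarrow> real" where
  "ln_remainder \<epsilon> v = (ln (1 + \<epsilon> * v) - \<epsilon> * v + \<epsilon>\<^sup>2 * v\<^sup>2 / 2) / \<epsilon> ^ 3"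

definition exp_remainder :: "real \<Rightarrow> real \<Rightarrow> real" where
  "exp_remainder \<epsilon> p = (exp (\<epsilon> * p) - 1 - \<epsilon> * p - \<epsilon>\<^sup>2 * p\<^sup>2 / 2) / \<epsilon> ^ 3"

text \<open>The division by \<open>\<epsilon> ^ 3\<close> is harmless at order zero by the cubic
  bound, and differentiation cancels it: the derivative
  \<open>(v s x)\<^sup>2 * (1 / (1 + e s * v s x)) * v' s x\<close> has no negative power of
  \<open>e s\<close>.\<close>

lemma bounded_derivs_ln_remainder:
  assumes e: "\<And>s. s \<in> S \<Longrightarrow> 0 < e s \<and> e s \<le> 1"
    and w: "\<And>s x. s \<in> S \<Longrightarrow> 0 \<le> w s x \<and> w s x \<le> 1"
    and v: "\<And>s x. s \<in> S \<Longrightarrow> v s x \<ge> 0"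
    and "bounded_derivs S w k v"
  shows "bounded_derivs S w k (\<lambda>s x. ln_remainder (e s) (v s x))"
  using assms(4)
proof (induction k)
  case 0
  have w1: "bounded_derivs S (\<lambda>_ _. 1) 0 v" using bounded_derivs_weaken[OF 0 w] .
  show ?case
  proof (rule bounded_derivs_0_dominated)
    show "bounded_derivs S w 0 (\<lambda>s x. v s x ^ 3)"
      using w by (intro bounded_derivs_power_Suc 0 w1) auto
    fix s x assume s: "s \<in> S"
    have "\<bar>ln (1 + e s * v s x) - e s * v s x + (e s * v s x)\<^sup>2 / 2\<bar> \<le> (e s * v s x) ^ 3"
      using e[OF s] v[OF s, of x] by (intro ln_add_one_third_order) auto
    then show "\<bar>ln_remainder (e s) (v s x)\<bar> \<le> 1 * \<bar>v s x ^ 3\<bar>"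
      using e[OF s] v[OF s, of x]
      by (simp add: ln_remainder_def power_mult_distrib abs_mult divide_simps mult_ac)
  qed (use w in auto)
next
  case (Suc k)
  from Suc.prems obtain v' where v': "\<And>s x. s \<in> S \<Longrightarrow> (v s has_real_derivative v' s x) (at x)"
    "bounded_derivs S w k v'" by (rule bounded_derivs_SucE) blast
  have vk: "bounded_derivs S w k v" using Suc.prems bounded_derivs_Suc_le by blast
  have v1: "bounded_derivs S (\<lambda>_ _. 1) k v" using bounded_derivs_weaken[OF vk w] .
  show ?case
  proof (rule bounded_derivs_SucI)
    show "bounded_derivs S w 0 (\<lambda>s x. ln_remainder (e s) (v s x))"
      using Suc.IH vk bounded_derivs_0 by blast
    show "((\<lambda>x. ln_remainder (e s) (v s x)) has_real_derivative
        (v s x)\<^sup>2 * (1 / (1 + e s * v s x)) * v' s x) (at x)" if s: "s \<in> S" for s x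
    proof -
      have pos: "e s > 0" "1 + e s * v s x > 0"
        using e[OF s] v[OF s, of x] by (auto intro!: add_pos_nonneg)
      show ?thesis unfolding ln_remainder_def
        using pos by (auto intro!: derivative_eq_intros v'(1) s simp: divide_simps)
          (simp add: algebra_simps eval_nat_numeral)
    qed
    have "bounded_derivs S (\<lambda>_ _. 1) k (\<lambda>s x. 1 / (1 + e s * v s x))"
    proof (rule bounded_derivs_inverse[where c = 1])
      show "bounded_derivs S (\<lambda>_ _. 1) k (\<lambda>s x. 1 + e s * v s x)"
        by (intro bounded_derivs_add bounded_derivs_const bounded_derivs_mult_left v1
            bounded_derivs_param_unit e) auto
    qed (use e v in \<open>auto simp: less_imp_le\<close>)
    then show "bounded_derivs S w k (\<lambda>s x. (v s x)\<^sup>2 * (1 / (1 + e s * v s x)) * v' s x)"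
      using w by (intro bounded_derivs_mult_left bounded_derivs_power v1 v') auto
  qed
qed

text \<open>In its second argument the remainder has derivative
  \<open>\<epsilon> * exp_remainder \<epsilon> p + p\<^sup>2 / 2\<close>. It reproduces itself
  without negative powers of \<epsilon>, so the induction closes.\<close>

lemma bounded_derivs_exp_remainder:
  assumes e: "\<And>s. s \<in> S \<Longrightarrow> 0 < e s \<and> e s \<le> 1"
    and w: "\<And>s x. s \<in> S \<Longrightarrow> 0 \<le> w s x \<and> w s x \<le> 1"
    and p: "\<And>s x. s \<in> S \<Longrightarrow> p s x \<ge> 0"
    and "bounded_derivs S w k p"
  shows "bounded_derivs S w k (\<lambda>s x. exp_remainder (e s) (p s x))"
  using assms(4)
proof (induction k)
  case 0
  have p1: "bounded_derivs S (\<lambda>_ _. 1) 0 p" using bounded_derivs_weaken[OF 0 w] .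
  obtain B where B: "\<And>s x. s \<in> S \<Longrightarrow> \<bar>p s x\<bar> \<le> B * 1"
    using bounded_derivs_bound[OF p1] by (metis zero_le_one)
  show ?case
  proof (rule bounded_derivs_0_dominated)
    show "bounded_derivs S w 0 (\<lambda>s x. p s x ^ 3)"
      using w by (intro bounded_derivs_power_Suc 0 p1) auto
    fix s x assume s: "s \<in> S"
    have "\<bar>exp (e s * p s x) - 1 - e s * p s x - (e s * p s x)\<^sup>2 / 2\<bar>
        \<le> exp (e s * p s x) * (e s * p s x) ^ 3"
      using e[OF s] p[OF s, of x] by (intro exp_third_order) auto
    also have "\<dots> \<le> exp B * (e s * p s x) ^ 3"
    proof -
      have "e s * p s x \<le> 1 * p s x" using e[OF s] p[OF s, of x] by (intro mult_right_mono) auto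
      then have "e s * p s x \<le> B" using B[OF s, of x] by linarith
      then show ?thesis using e[OF s] p[OF s, of x] by (intro mult_right_mono) auto
    qed
    finally show "\<bar>exp_remainder (e s) (p s x)\<bar> \<le> exp B * \<bar>p s x ^ 3\<bar>"
      using e[OF s] p[OF s, of x]
      by (simp add: exp_remainder_def power_mult_distrib abs_mult divide_simps mult_ac)
  qed (use w in auto)
next
  case (Suc k)
  from Suc.prems obtain p' where p': "\<And>s x. s \<in> S \<Longrightarrow> (p s has_real_derivative p' s x) (at x)"
    "bounded_derivs S w k p'" by (rule bounded_derivs_SucE) blast
  have pk: "bounded_derivs S w k p" using Suc.prems bounded_derivs_Suc_le by blast
  have IH: "bounded_derivs S w k (\<lambda>s x. exp_remainder (e s) (p s x))" using Suc.IH pk .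
  show ?case
  proof (rule bounded_derivs_SucI)
    show "bounded_derivs S w 0 (\<lambda>s x. exp_remainder (e s) (p s x))"
      using IH bounded_derivs_0 by blast
    show "((\<lambda>x. exp_remainder (e s) (p s x)) has_real_derivative
        (e s * exp_remainder (e s) (p s x) + (1/2) * (p s x)\<^sup>2) * p' s x) (at x)" if s: "s \<in> S" for s x
    proof -
      have pos: "e s > 0" using e[OF s] by auto
      show ?thesis unfolding exp_remainder_def
        using pos by (auto intro!: derivative_eq_intros p'(1) s simp: divide_simps)
          (simp add: algebra_simps eval_nat_numeral)
    qed
    show "bounded_derivs S w k (\<lambda>s x. (e s * exp_remainder (e s) (p s x) + (1/2) * (p s x)\<^sup>2) * p' s x)"
      using w by (intro bounded_derivs_mult_left bounded_derivs_power bounded_derivs_add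
          bounded_derivs_const bounded_derivs_weaken[OF pk w] bounded_derivs_weaken[OF IH w] p'
          bounded_derivs_param_unit e) auto
  qed
qed

section \<open>The scaled balance laws expanded in powers of \<epsilon>\<close>

context
  fixes V \<gamma> :: real
begin

text \<open>With \<open>n = 1 + \<epsilon> v\<close> and \<open>\<phi> = \<epsilon> \<psi>\<close>, the pressure balance reads \<open>\<psi> = v + \<epsilon> * potential_shift \<epsilon> v\<close>
  and Poisson's equation \<open>\<psi>'' = 2 V \<gamma> \<psi> - V\<^sup>2 \<psi>\<^sup>2 + \<epsilon> * ode_remainder \<epsilon> v \<psi>\<close>.\<close>

definition shift_remainder :: "real \<Rightarrow> real \<Rightarrow> real" where
  "shift_remainder \<epsilon> v = \<gamma>\<^sup>2 * v - (3/2) * (2 * V * \<gamma> + \<gamma>\<^sup>2 * \<epsilon>) * v\<^sup>2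
     + (V + \<gamma> * \<epsilon>)\<^sup>2 * ((1 / (1 + \<epsilon> * v))\<^sup>2 * (2 * v ^ 3 + (3/2) * \<epsilon> * v ^ 4))
     - (V\<^sup>2 - 1) * ln_remainder \<epsilon> v"

definition potential_shift :: "real \<Rightarrow> real \<Rightarrow> real" where
  "potential_shift \<epsilon> v = (2 * V * \<gamma>) * v - (V\<^sup>2 + 1/2) * v\<^sup>2 + \<epsilon> * shift_remainder \<epsilon> v"

definition ode_remainder :: "real \<Rightarrow> real \<Rightarrow> real \<Rightarrow> real" where
  "ode_remainder \<epsilon> v \<psi> = shift_remainder \<epsilon> v + exp_remainder \<epsilon> \<psi>
     - (2 * V * \<gamma>) * potential_shift \<epsilon> v + (V\<^sup>2 + 1/2) * ((\<psi> + v) * potential_shift \<epsilon> v)"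

text \<open>At first order the coefficient of \<open>v\<close> is V^2 - (V^2 - 1) = 1, which is what
  the choice of V achieves: \<phi> and n - 1 agree to leading order. At the next order the excess
  speed gives 2 V \<gamma>, and the quadratic terms add up to -3/2 V^2 + (V^2 - 1)/2 = - (V^2 +
  1/2).\<close>

lemma potential_expansion:
  assumes "\<epsilon> > 0" "v \<ge> 0"
  shows "(V + \<gamma> * \<epsilon>)\<^sup>2 / 2 * (1 - 1 / (1 + \<epsilon> * v)\<^sup>2) - (V\<^sup>2 - 1) * ln (1 + \<epsilon> * v)
    = \<epsilon> * (v + \<epsilon> * potential_shift \<epsilon> v)"
proof -
  define m where "m = 1 + \<epsilon> * v"
  have m: "m > 0" using assms by (auto simp: m_def intro!: add_pos_nonneg)
  have ln: "ln m = \<epsilon> ^ 3 * ln_remainder \<epsilon> v + \<epsilon> * v - \<epsilon>\<^sup>2 * v\<^sup>2 / 2"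
    using assms by (simp add: ln_remainder_def m_def)
  \<comment> \<open>The quadratic Taylor polynomial of the inverse square with its exact remainder,
    so that the expansion is an identity and not an estimate.\<close>
  have rat: "1 - 1 / m\<^sup>2 = 2 * (\<epsilon> * v) - 3 * (\<epsilon> * v)\<^sup>2 + (4 * (\<epsilon> * v) ^ 3 + 3 * (\<epsilon> * v) ^ 4) * (1 / m)\<^sup>2"
    using m by (simp add: divide_simps) (simp add: m_def algebra_simps eval_nat_numeral)
  define J where "J = (1 / m)\<^sup>2"
  show ?thesis
    unfolding potential_shift_def shift_remainder_def m_def[symmetric] ln rat J_def[symmetric]
    by (simp add: field_simps eval_nat_numeral)
qed

text \<open>The KdV nonlinearity arises here: 1/2 from the exponential and - (V^2 + 1/2) from the
  pressure balance add up to - V^2. Replacing \<open>v\<close> by \<psi> in the leading terms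
  changes them by O(\<epsilon>), which goes into \<open>ode_remainder\<close>.\<close>

lemma poisson_expansion:
  assumes "\<epsilon> > 0" and \<psi>: "\<psi> = v + \<epsilon> * potential_shift \<epsilon> v"
  shows "(exp (\<epsilon> * \<psi>) - (1 + \<epsilon> * v)) / \<epsilon>\<^sup>2
    = potential_shift \<epsilon> v + (1/2) * \<psi>\<^sup>2 + \<epsilon> * exp_remainder \<epsilon> \<psi>" (is ?A)
    and "potential_shift \<epsilon> v + (1/2) * \<psi>\<^sup>2 + \<epsilon> * exp_remainder \<epsilon> \<psi>
    = (2 * V * \<gamma>) * \<psi> - V\<^sup>2 * \<psi>\<^sup>2 + \<epsilon> * ode_remainder \<epsilon> v \<psi>" (is ?B)
proof -
  have "exp (\<epsilon> * \<psi>) = \<epsilon> ^ 3 * exp_remainder \<epsilon> \<psi> + 1 + \<epsilon> * \<psi> + \<epsilon>\<^sup>2 * \<psi>\<^sup>2 / 2"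
    using assms by (simp add: exp_remainder_def)
  moreover have "\<epsilon> * \<psi> = \<epsilon> * v + \<epsilon>\<^sup>2 * potential_shift \<epsilon> v" by (simp add: \<psi> algebra_simps power2_eq_square)
  ultimately show ?A using assms(1)
    by (simp add: divide_simps) (simp add: algebra_simps eval_nat_numeral)
  define M where "M = potential_shift \<epsilon> v"
  have v: "v = \<psi> - \<epsilon> * M" using \<psi> by (simp add: M_def)
  have "M = (2 * V * \<gamma>) * v - (V\<^sup>2 + 1/2) * v\<^sup>2 + \<epsilon> * shift_remainder \<epsilon> v"
    by (simp add: M_def potential_shift_def)
  also have "\<dots> = (2 * V * \<gamma>) * \<psi> - (V\<^sup>2 + 1/2) * \<psi>\<^sup>2 + \<epsilon> * (shift_remainder \<epsilon> v
      - (2 * V * \<gamma>) * M + (V\<^sup>2 + 1/2) * ((\<psi> + v) * M))"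
  proof -
    have "v\<^sup>2 = \<psi>\<^sup>2 - \<epsilon> * ((\<psi> + v) * M)" "(2 * V * \<gamma>) * v = (2 * V * \<gamma>) * \<psi> - \<epsilon> * ((2 * V * \<gamma>) * M)"
      by (simp_all add: v power2_eq_square algebra_simps)
    then show ?thesis by (simp only:) (simp add: algebra_simps)
  qed
  finally show ?B
    unfolding ode_remainder_def M_def[symmetric] by (simp add: algebra_simps)
qed

text \<open>Every summand contains \<open>v\<close> or \<open>p\<close>, or a remainder that carries
  their weight, so one factor supplies the decay and the others are merely bounded.\<close>

lemma bounded_derivs_expansion:
  assumes e: "\<And>s. s \<in> S \<Longrightarrow> 0 < e s \<and> e s \<le> 1"
    and w: "\<And>s x. s \<in> S \<Longrightarrow> 0 \<le> w s x \<and> w s x \<le> 1"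
    and v: "\<And>s x. s \<in> S \<Longrightarrow> v s x \<ge> 0" "bounded_derivs S w k v"
  shows "bounded_derivs S w k (\<lambda>s x. shift_remainder (e s) (v s x))"
    and "bounded_derivs S w k (\<lambda>s x. potential_shift (e s) (v s x))"
    and "\<lbrakk>\<And>s x. s \<in> S \<Longrightarrow> p s x \<ge> 0; bounded_derivs S w k p\<rbrakk> \<Longrightarrow>
      bounded_derivs S w k (\<lambda>s x. ode_remainder (e s) (v s x) (p s x))"
proof -
  have w0: "\<And>s x. s \<in> S \<Longrightarrow> w s x \<ge> 0" using w by auto
  have e1: "bounded_derivs S (\<lambda>_ _. 1) k (\<lambda>s x. e s)"
    by (rule bounded_derivs_param_unit[OF e])
  have v1: "bounded_derivs S (\<lambda>_ _. 1) k v" using bounded_derivs_weaken[OF v(2) w] .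
  have inv: "bounded_derivs S (\<lambda>_ _. 1) k (\<lambda>s x. 1 / (1 + e s * v s x))"
  proof (rule bounded_derivs_inverse[where c = 1])
    show "bounded_derivs S (\<lambda>_ _. 1) k (\<lambda>s x. 1 + e s * v s x)"
      by (intro bounded_derivs_add bounded_derivs_const bounded_derivs_mult_left v1 e1) auto
  qed (use e v in \<open>auto simp: less_imp_le\<close>)
  show W: "bounded_derivs S w k (\<lambda>s x. shift_remainder (e s) (v s x))"
    unfolding shift_remainder_def
  proof (intro bounded_derivs_add bounded_derivs_diff w0)
    show "bounded_derivs S w k (\<lambda>s x. \<gamma>\<^sup>2 * v s x)"
      by (intro bounded_derivs_mult_left bounded_derivs_const v w0)
    show "bounded_derivs S w k (\<lambda>s x. (3/2) * (2 * V * \<gamma> + \<gamma>\<^sup>2 * e s) * (v s x)\<^sup>2)"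
    proof (rule bounded_derivs_mult_left)
      show "bounded_derivs S (\<lambda>_ _. 1) k (\<lambda>s x. (3/2) * (2 * V * \<gamma> + \<gamma>\<^sup>2 * e s))"
        by (intro bounded_derivs_mult_left bounded_derivs_add bounded_derivs_const e1) auto
      show "bounded_derivs S w k (\<lambda>s x. (v s x)\<^sup>2)"
        by (intro bounded_derivs_power_Suc v v1 w0) auto
    qed (rule w0)
    show "bounded_derivs S w k (\<lambda>s x. (V + \<gamma> * e s)\<^sup>2 *
        ((1 / (1 + e s * v s x))\<^sup>2 * (2 * v s x ^ 3 + (3/2) * e s * v s x ^ 4)))"
    proof (intro bounded_derivs_mult_left[where w = w]
        bounded_derivs_add[where w = w] bounded_derivs_power_Suc[where w = w] w0 v v1)
      show "bounded_derivs S (\<lambda>_ _. 1) k (\<lambda>s x. (V + \<gamma> * e s)\<^sup>2)"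
        by (intro bounded_derivs_power bounded_derivs_add bounded_derivs_mult_left
            bounded_derivs_const e1) auto
      show "bounded_derivs S (\<lambda>_ _. 1) k (\<lambda>s x. (3/2) * e s)"
        by (intro bounded_derivs_mult_left bounded_derivs_const e1) auto
      show "bounded_derivs S (\<lambda>_ _. 1) k (\<lambda>s x. (1 / (1 + e s * v s x))\<^sup>2)"
        by (intro bounded_derivs_power inv)
      show "bounded_derivs S (\<lambda>_ _. 1) k (\<lambda>s x. 2)" by (rule bounded_derivs_const)
    qed auto
    show "bounded_derivs S w k (\<lambda>s x. (V\<^sup>2 - 1) * ln_remainder (e s) (v s x))"
      by (intro bounded_derivs_mult_left bounded_derivs_const w0
          bounded_derivs_ln_remainder[OF e w v])
  qed
  show M: "bounded_derivs S w k (\<lambda>s x. potential_shift (e s) (v s x))"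
    unfolding potential_shift_def
    by (intro bounded_derivs_add bounded_derivs_diff w0 bounded_derivs_mult_left[where w = w]
        bounded_derivs_const v e1 W bounded_derivs_power_Suc v1) auto
  assume p: "\<And>s x. s \<in> S \<Longrightarrow> p s x \<ge> 0" "bounded_derivs S w k p"
  have p1: "bounded_derivs S (\<lambda>_ _. 1) k p" using bounded_derivs_weaken[OF p(2) w] .
  show "bounded_derivs S w k (\<lambda>s x. ode_remainder (e s) (v s x) (p s x))"
    unfolding ode_remainder_def
    by (intro bounded_derivs_add bounded_derivs_diff w0 bounded_derivs_mult_left[where w = w]
        bounded_derivs_const bounded_derivs_exp_remainder[OF e w p] W M
        bounded_derivs_add[where w = "\<lambda>_ _. 1"] p1 v1)
qed

text \<open>The pair (\<epsilon>, v) itself serves as the index of a family of functions constant in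
  \<open>x\<close>, with weight \<open>v / K\<close>. The order-zero case of the family estimates
  then yields pointwise bounds proportional to \<open>v\<close>.\<close>

lemma expansion_uniform:
  assumes "K > 0"
  obtains \<epsilon>0 C where "0 < \<epsilon>0" "\<epsilon>0 \<le> 1" "C > 0"
    "\<And>\<epsilon> v \<psi>. \<lbrakk>0 < \<epsilon>; \<epsilon> \<le> \<epsilon>0; 0 \<le> v; v \<le> K; \<psi> = v + \<epsilon> * potential_shift \<epsilon> v\<rbrakk> \<Longrightarrow>
      v / 2 \<le> \<psi> \<and> \<psi> \<le> 2 * v \<and> \<bar>ode_remainder \<epsilon> v \<psi>\<bar> \<le> C * \<psi>"
proof -
  define w :: "real \<times> real \<Rightarrow> real \<Rightarrow> real" where "w = (\<lambda>s x. snd s / K)"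
  define S :: "real \<Rightarrow> (real \<times> real) set" where "S = (\<lambda>\<epsilon>0. {0<..\<epsilon>0} \<times> {0..K})"
  have v: "bounded_derivs (S \<epsilon>0) w 0 (\<lambda>s x. snd s)" for \<epsilon>0
    using assms by (auto simp: w_def S_def intro!: exI[of _ K])
  have sides: "0 < fst s \<and> fst s \<le> 1" "0 \<le> w s x \<and> w s x \<le> 1" "snd s \<ge> 0"
    if "s \<in> S \<epsilon>0" "\<epsilon>0 \<le> 1" for s x \<epsilon>0
    using that assms by (auto simp: S_def w_def divide_simps)
  have "bounded_derivs (S 1) w 0 (\<lambda>s x. potential_shift (fst s) (snd s))"
    by (rule bounded_derivs_expansion(2)[OF sides(1,2,3)[OF _ order_refl] v])
  then obtain A where A: "A > 0"
    "\<And>s x. s \<in> S 1 \<Longrightarrow> w s x \<ge> 0 \<Longrightarrow> \<bar>potential_shift (fst s) (snd s)\<bar> \<le> A * w s x"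
    by (rule bounded_derivs_bound) blast
  have M: "\<bar>potential_shift \<epsilon> v\<bar> \<le> A / K * v" if "0 < \<epsilon>" "\<epsilon> \<le> 1" "0 \<le> v" "v \<le> K" for \<epsilon> v
    using A(2)[of "(\<epsilon>, v)"] that assms by (auto simp: S_def w_def)
  \<comment> \<open>With this choice \<open>\<epsilon> * potential_shift \<epsilon> v\<close> is at
    most \<open>v / 2\<close> in absolute value, so \<psi> and \<open>v\<close> are
    comparable.\<close>
  define \<epsilon>0 where "\<epsilon>0 = min 1 (K / A / 2)"
  have \<epsilon>0: "0 < \<epsilon>0" "\<epsilon>0 \<le> 1" using A assms by (auto simp: \<epsilon>0_def)
  have \<psi>: "v / 2 \<le> v + \<epsilon> * potential_shift \<epsilon> v \<and> v + \<epsilon> * potential_shift \<epsilon> v \<le> 2 * v"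
    if "0 < \<epsilon>" "\<epsilon> \<le> \<epsilon>0" "0 \<le> v" "v \<le> K" for \<epsilon> v
  proof -
    have "\<bar>\<epsilon> * potential_shift \<epsilon> v\<bar> \<le> (K / A / 2) * (A / K * v)"
      unfolding abs_mult using M[of \<epsilon> v] that assms A by (intro mult_mono) (auto simp: \<epsilon>0_def)
    also have "\<dots> = v / 2" using assms A by simp
    finally show ?thesis by (intro conjI; linarith)
  qed
  define p where "p = (\<lambda>(s :: real \<times> real) (x :: real). snd s + fst s * potential_shift (fst s) (snd s))"
  have p: "p s x \<ge> 0" "p s x \<le> 2 * snd s" if "s \<in> S \<epsilon>0" for s x
    using \<psi>[of "fst s" "snd s"] that by (auto simp: p_def S_def)
  have "\<bar>p s x\<bar> \<le> 2 * \<bar>snd s\<bar>" if "s \<in> S \<epsilon>0" for s x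
    using p[OF that, of x] by auto
  then have pb: "bounded_derivs (S \<epsilon>0) w 0 p"
    using sides(2) \<epsilon>0 by (intro bounded_derivs_0_dominated[OF v, where K = 2]) auto
  have "bounded_derivs (S \<epsilon>0) w 0 (\<lambda>s x. ode_remainder (fst s) (snd s) (p s x))"
    by (rule bounded_derivs_expansion(3)[OF sides(1,2,3)[OF _ \<epsilon>0(2)] v p(1) pb])
  then obtain C where C: "C > 0" "\<And>s x. s \<in> S \<epsilon>0 \<Longrightarrow> w s x \<ge> 0 \<Longrightarrow> \<bar>ode_remainder (fst s) (snd s) (p s x)\<bar> \<le> C * w s x"
    by (rule bounded_derivs_bound) blast
  show ?thesis
  proof (rule that[OF \<epsilon>0, of "2 * C / K"])
    fix \<epsilon> v \<psi> assume *: "0 < \<epsilon>" "\<epsilon> \<le> \<epsilon>0" "0 \<le> v" "v \<le> K" "\<psi> = v + \<epsilon> * potential_shift \<epsilon> v"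
    have b: "v / 2 \<le> \<psi> \<and> \<psi> \<le> 2 * v" using \<psi> * by auto
    have "\<bar>ode_remainder \<epsilon> v \<psi>\<bar> \<le> C * (v / K)"
      using C(2)[of "(\<epsilon>, v)"] * assms by (auto simp: S_def w_def p_def)
    also have "\<dots> \<le> C * ((2 * \<psi>) / K)"
      using b C assms by (intro mult_left_mono divide_right_mono) auto
    finally show "v / 2 \<le> \<psi> \<and> \<psi> \<le> 2 * v \<and> \<bar>ode_remainder \<epsilon> v \<psi>\<bar> \<le> 2 * C / K * \<psi>"
      using b by (simp add: mult_ac)
  qed (use C assms in auto)
qed

end

section \<open>Amplitude and energy of solitary waves\<close>

text \<open>The energy defect, taken with either sign, plus \<open>a * (\<psi> x)\<^sup>2\<close>
  has derivative 2 \<psi>' times a nonnegative factor. It is therefore nonincreasing, and as it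
  tends to 0 it is nonnegative at \<open>x1\<close>.\<close>

lemma energy_estimate:
  fixes \<psi> :: "real \<Rightarrow> real"
  assumes \<psi>: "\<And>x. (\<psi> has_real_derivative \<psi>' x) (at x)"
    and \<psi>': "\<And>x. (\<psi>' has_real_derivative \<psi>'' x) (at x)"
    and "\<And>x. x \<ge> x1 \<Longrightarrow> \<psi>' x \<le> 0"
    and ode: "\<And>x. x \<ge> x1 \<Longrightarrow> \<bar>\<psi>'' x - (q * \<psi> x - r * (\<psi> x)\<^sup>2)\<bar> \<le> a * \<psi> x"
    and lim: "(\<psi> \<longlongrightarrow> 0) at_top" "(\<psi>' \<longlongrightarrow> 0) at_top"
  shows "\<bar>(\<psi>' x1)\<^sup>2 - (q * (\<psi> x1)\<^sup>2 - 2/3 * r * (\<psi> x1) ^ 3)\<bar> \<le> a * (\<psi> x1)\<^sup>2"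
proof -
  define G where "G = (\<lambda>c x. c * ((\<psi>' x)\<^sup>2 - (q * (\<psi> x)\<^sup>2 - 2/3 * r * (\<psi> x) ^ 3)) + a * (\<psi> x)\<^sup>2)"
  have G: "G c x1 \<ge> 0" if c: "\<bar>c\<bar> = 1" for c
  proof (rule tendsto_upperbound)
    have "(G c \<longlongrightarrow> c * (0\<^sup>2 - (q * 0\<^sup>2 - 2/3 * r * 0 ^ 3)) + a * 0\<^sup>2) at_top"
      unfolding G_def by (intro tendsto_intros lim)
    then show "(G c \<longlongrightarrow> 0) at_top" by simp
    have "G c x \<le> G c x1" if "x \<ge> x1" for x
    proof (rule DERIV_nonpos_imp_nonincreasing[OF that])
      fix t assume t: "x1 \<le> t" "t \<le> x"
      have "(G c has_real_derivative
          2 * \<psi>' t * (c * (\<psi>'' t - (q * \<psi> t - r * (\<psi> t)\<^sup>2)) + a * \<psi> t)) (at t)"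
        unfolding G_def
        by (auto intro!: derivative_eq_intros \<psi> \<psi>' simp: algebra_simps power2_eq_square)
      moreover have "\<bar>c * (\<psi>'' t - (q * \<psi> t - r * (\<psi> t)\<^sup>2))\<bar> \<le> a * \<psi> t"
        using ode[OF t(1)] c by (simp add: abs_mult)
      then have "- (c * (\<psi>'' t - (q * \<psi> t - r * (\<psi> t)\<^sup>2))) \<le> a * \<psi> t"
        by (simp only: abs_le_iff)
      then have "0 \<le> c * (\<psi>'' t - (q * \<psi> t - r * (\<psi> t)\<^sup>2)) + a * \<psi> t" by linarith
      then have "2 * \<psi>' t * (c * (\<psi>'' t - (q * \<psi> t - r * (\<psi> t)\<^sup>2)) + a * \<psi> t) \<le> 0"
        using assms(3)[OF t(1)] by (intro mult_nonpos_nonneg[of "2 * \<psi>' t"]) auto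
      ultimately show "\<exists>y. (G c has_real_derivative y) (at t) \<and> y \<le> 0" by blast
    qed
    then show "\<forall>\<^sub>F x in at_top. G c x \<le> G c x1"
      by (rule eventually_mono[OF eventually_ge_at_top[of x1]])
  qed simp
  show ?thesis using G[of 1] G[of "-1"] by (auto simp: G_def abs_le_iff)
qed

lemma constant_of_deriv_zero_limit:
  fixes f :: "real \<Rightarrow> real"
  assumes "\<And>x. (f has_real_derivative 0) (at x)" "(f \<longlongrightarrow> l) at_top"
  shows "f x = l"
proof -
  have "f y = f x" for y using DERIV_isconst_all[of f] assms(1) by blast
  then have "f = (\<lambda>_. f x)" by auto
  then have "(f \<longlongrightarrow> f x) at_top" by (metis tendsto_const)
  then show ?thesis using assms(2) tendsto_unique trivial_limit_at_top_linorder by blast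
qed

lemma decreasing_half_line:
  fixes f :: "real \<Rightarrow> real"
  assumes f: "\<And>x. (f has_real_derivative f' x) (at x)" and neg: "\<And>x. x > 0 \<Longrightarrow> f' x < 0"
    and "0 \<le> a" "a < b"
  shows "f b < f a"
proof (rule DERIV_neg_imp_decreasing_open[OF \<open>a < b\<close>])
  fix x assume "a < x"
  then show "\<exists>y. (f has_real_derivative y) (at x) \<and> y < 0"
    using f[of x] neg[of x] \<open>0 \<le> a\<close> by (intro exI[of _ "f' x"]) auto
next
  show "continuous_on {a..b} f"
    using DERIV_isCont[OF f] by (intro continuous_at_imp_continuous_on) auto
qed

lemma decreasing_limit_less:
  fixes f :: "real \<Rightarrow> real"
  assumes "\<And>x. (f has_real_derivative f' x) (at x)" "\<And>x. x > 0 \<Longrightarrow> f' x < 0"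
    and "(f \<longlongrightarrow> l) at_top" "\<And>x. f (- x) = f x"
  shows "l < f x"
proof -
  note dec = decreasing_half_line[OF assms(1,2)]
  have pos: "l < f x" if "x \<ge> 0" for x
  proof -
    \<comment> \<open>Passing to the limit gives only a weak inequality; comparing at
      \<open>x + 1\<close> leaves the strict step from \<open>x + 1\<close> back to
      \<open>x\<close>.\<close>
    have "l \<le> f (x + 1)"
    proof (rule tendsto_upperbound[OF assms(3)])
      show "\<forall>\<^sub>F y in at_top. f y \<le> f (x + 1)"
        by (rule eventually_mono[OF eventually_gt_at_top[of "x + 1"]])
          (use dec[of "x + 1"] that in \<open>auto intro: less_imp_le\<close>)
    qed simp
    then show ?thesis using dec[of x "x + 1"] that by simp
  qed
  show ?thesis using pos[of x] pos[of "-x"] assms(4)[of x] by (cases "x \<ge> 0") auto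
qed

section \<open>First integrals and amplitude of a single solitary wave\<close>

context
  fixes \<sigma> \<gamma> \<epsilon> V c :: real and n u \<phi> :: "real \<Rightarrow> real"
  assumes \<sigma>: "\<sigma> \<ge> 0" and \<gamma>: "\<gamma> > 0" and \<epsilon>: "\<epsilon> > 0"
    and wave: "solitary_wave \<sigma> \<gamma> \<epsilon> n u \<phi>"
    and V: "V = sqrt (1 + \<sigma>)" and c: "c = V + \<gamma> * \<epsilon>"
begin

lemma wave_smooth:
  shows "(n has_real_derivative deriv n x) (at x)" "(u has_real_derivative deriv u x) (at x)"
    "(\<phi> has_real_derivative deriv \<phi> x) (at x)"
    "(deriv \<phi> has_real_derivative (exp (\<phi> x) - n x) / \<epsilon>) (at x)"
proof -
  have *: "(deriv ^^ k) n differentiable at x" "(deriv ^^ k) u differentiable at x"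
    "(deriv ^^ k) \<phi> differentiable at x" for k
    using wave by (auto simp: solitary_wave_def smooth_real_def Let_def)
  show "(n has_real_derivative deriv n x) (at x)" "(u has_real_derivative deriv u x) (at x)"
    "(\<phi> has_real_derivative deriv \<phi> x) (at x)"
    using *[of 0] by (auto simp: DERIV_deriv_iff_real_differentiable)
  have "(deriv \<phi> has_real_derivative deriv (deriv \<phi>) x) (at x)"
    using *(3)[of 1] by (simp add: DERIV_deriv_iff_real_differentiable)
  moreover have "\<epsilon> * deriv (deriv \<phi>) x = exp (\<phi> x) - n x"
    using wave by (simp add: solitary_wave_def Let_def)
  ultimately show "(deriv \<phi> has_real_derivative (exp (\<phi> x) - n x) / \<epsilon>) (at x)"
    using \<epsilon> by (metis nonzero_mult_div_cancel_left less_irrefl)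
qed

lemma wave_limits: "(n \<longlongrightarrow> 1) at_top" "(u \<longlongrightarrow> 0) at_top" "(\<phi> \<longlongrightarrow> 0) at_top"
  and wave_even: "n (- x) = n x" "\<phi> (- x) = \<phi> x"
  and wave_decreasing: "x > 0 \<Longrightarrow> deriv n x < 0" "x > 0 \<Longrightarrow> deriv \<phi> x < 0"
  using wave unfolding solitary_wave_def Let_def by blast+

lemma n_gt_1: "n x > 1"
  by (rule decreasing_limit_less[OF wave_smooth(1) wave_decreasing(1) wave_limits(1) wave_even(1)])

lemma phi_pos: "\<phi> x > 0"
  by (rule decreasing_limit_less[OF wave_smooth(3) wave_decreasing(2) wave_limits(3) wave_even(2)])

lemma n_nonincreasing:
  assumes "0 \<le> x" "x \<le> y"
  shows "n y \<le> n x"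
proof (cases "x = y")
  case False
  then have "n y < n x"
    using assms by (intro decreasing_half_line[OF wave_smooth(1) wave_decreasing(1)]) auto
  then show ?thesis by simp
qed auto

lemma velocity_eq: "u x = c * (1 - 1 / n x)"
proof -
  have "n x * u x - c * n x = - c"
  proof (rule constant_of_deriv_zero_limit[where f = "\<lambda>x. n x * u x - c * n x"])
    fix x
    have "((\<lambda>x. n x * u x) has_real_derivative deriv n x * u x + n x * deriv u x) (at x)"
      by (auto intro!: derivative_eq_intros wave_smooth)
    then have "((\<lambda>x. n x * u x) has_real_derivative deriv (\<lambda>x. n x * u x) x) (at x)"
      using DERIV_imp_deriv by metis
    moreover have "- c * deriv n x + deriv (\<lambda>x. n x * u x) x = 0"
      using wave by (auto simp: solitary_wave_def Let_def c V)
    ultimately have "((\<lambda>x. n x * u x) has_real_derivative c * deriv n x) (at x)" by simp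
    then show "((\<lambda>x. n x * u x - c * n x) has_real_derivative 0) (at x)"
      using DERIV_diff[OF _ DERIV_cmult[OF wave_smooth(1), of c]] by fastforce
    have "((\<lambda>x. n x * u x - c * n x) \<longlongrightarrow> 1 * 0 - c * 1) at_top"
      by (intro tendsto_intros wave_limits)
    then show "((\<lambda>x. n x * u x - c * n x) \<longlongrightarrow> - c) at_top" by simp
  qed
  then show ?thesis using n_gt_1[of x] by (simp add: field_simps)
qed

lemma potential_eq: "\<phi> x = c\<^sup>2 / 2 * (1 - 1 / (n x)\<^sup>2) - \<sigma> * ln (n x)"
proof -
  have "\<phi> x - c * u x + (u x)\<^sup>2 / 2 + \<sigma> * ln (n x) = 0"
  proof (rule constant_of_deriv_zero_limit[where f = "\<lambda>x. \<phi> x - c * u x + (u x)\<^sup>2 / 2 + \<sigma> * ln (n x)"])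
    fix x
    have "- c * deriv u x + u x * deriv u x + \<sigma> * deriv n x / n x = - deriv \<phi> x"
      using wave by (auto simp: solitary_wave_def Let_def c V)
    then have "deriv \<phi> x - c * deriv u x + u x * deriv u x + \<sigma> * (deriv n x / n x) = 0"
      by simp
    moreover have "((\<lambda>x. \<phi> x - c * u x + (u x)\<^sup>2 / 2 + \<sigma> * ln (n x)) has_real_derivative
        deriv \<phi> x - c * deriv u x + u x * deriv u x + \<sigma> * (deriv n x / n x)) (at x)"
      using n_gt_1[of x] by (auto intro!: derivative_eq_intros wave_smooth)
    ultimately show "((\<lambda>x. \<phi> x - c * u x + (u x)\<^sup>2 / 2 + \<sigma> * ln (n x)) has_real_derivative 0) (at x)"
      by metis
    have "((\<lambda>x. \<phi> x - c * u x + (u x)\<^sup>2 / 2 + \<sigma> * ln (n x)) \<longlongrightarrow> 0 - c * 0 + 0\<^sup>2 / 2 + \<sigma> * ln 1) at_top"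
      by (intro tendsto_intros wave_limits) auto
    then show "((\<lambda>x. \<phi> x - c * u x + (u x)\<^sup>2 / 2 + \<sigma> * ln (n x)) \<longlongrightarrow> 0) at_top" by simp
  qed
  then have "\<phi> x = c * (c * (1 - 1 / n x)) - (c * (1 - 1 / n x))\<^sup>2 / 2 - \<sigma> * ln (n x)"
    unfolding velocity_eq by simp
  also have "c * (c * (1 - j)) - (c * (1 - j))\<^sup>2 / 2 = c\<^sup>2 / 2 * (1 - j\<^sup>2)" for j
    by (simp add: field_simps power2_eq_square)
  finally show ?thesis by (simp add: power_one_over)
qed

text \<open>The factor is the derivative of \<phi> with respect to n; it is inverted later to
  recover the slope of n from that of \<phi>.\<close>

lemma deriv_phi_eq: "deriv \<phi> x = (c\<^sup>2 / n x ^ 3 - \<sigma> / n x) * deriv n x"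
proof -
  have nz: "n x > 0" "n x \<noteq> 0" using n_gt_1[of x] by auto
  have inv: "((\<lambda>x. 1 / n x) has_real_derivative - deriv n x / (n x)\<^sup>2) (at x)"
    using nz by (auto intro!: derivative_eq_intros wave_smooth simp: power2_eq_square)
  have ln: "((\<lambda>x. ln (n x)) has_real_derivative deriv n x / n x) (at x)"
    using nz by (auto intro!: derivative_eq_intros wave_smooth)
  have "((\<lambda>x. c\<^sup>2 / 2 * (1 - (1 / n x)\<^sup>2) - \<sigma> * ln (n x)) has_real_derivative
      c\<^sup>2 / 2 * (0 - 2 * (- deriv n x / (n x)\<^sup>2 * (1 / n x))) - \<sigma> * (deriv n x / n x)) (at x)"
    using DERIV_diff[OF DERIV_cmult[OF DERIV_diff[OF DERIV_const DERIV_power[OF inv, of 2]], where c = "c\<^sup>2 / 2"]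
        DERIV_cmult[OF ln, where c = \<sigma>]] by (simp add: mult.assoc)
  moreover have "c\<^sup>2 / 2 * (0 - 2 * (- deriv n x / (n x)\<^sup>2 * (1 / n x))) - \<sigma> * (deriv n x / n x)
      = (c\<^sup>2 / n x ^ 3 - \<sigma> / n x) * deriv n x"
  proof -
    have "deriv n x / (n x)\<^sup>2 * (1 / n x) = deriv n x / n x ^ 3"
      by (simp add: power2_eq_square power3_eq_cube)
    moreover have "c\<^sup>2 / 2 * (0 - 2 * (- deriv n x / (n x)\<^sup>2 * (1 / n x))) - \<sigma> * (deriv n x / n x)
        = c\<^sup>2 * (deriv n x / (n x)\<^sup>2 * (1 / n x)) - \<sigma> * (deriv n x / n x)" by simp
    ultimately show ?thesis by (simp only: left_diff_distrib times_divide_eq_left times_divide_eq_right)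
  qed
  moreover have "(\<lambda>x. c\<^sup>2 / 2 * (1 - (1 / n x)\<^sup>2) - \<sigma> * ln (n x)) = \<phi>"
    using potential_eq by (auto simp: power_one_over)
  ultimately have "(\<phi> has_real_derivative (c\<^sup>2 / n x ^ 3 - \<sigma> / n x) * deriv n x) (at x)"
    by simp
  then show ?thesis by (rule DERIV_imp_deriv)
qed

lemma deriv_phi_0: "deriv \<phi> 0 = 0"
proof -
  have "(\<phi> has_real_derivative - deriv \<phi> 0) (at 0)"
    using wave_smooth(3)[of "- 0"] wave_even(2) unfolding DERIV_mirror by simp
  then show ?thesis using wave_smooth(3)[of 0] DERIV_unique by fastforce
qed

text \<open>Both \<phi> and, by Poisson's equation, its second derivative tend to 0, and
  interpolation passes this to the first derivative. The margin e/4 for each yields 3/4 e in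
  total.\<close>

lemma deriv_phi_tendsto: "(deriv \<phi> \<longlongrightarrow> 0) at_top"
proof (rule tendstoI)
  fix e :: real assume "e > 0"
  have "((\<lambda>x. (exp (\<phi> x) - n x) / \<epsilon>) \<longlongrightarrow> (exp 0 - 1) / \<epsilon>) at_top"
    using \<epsilon> by (intro tendsto_intros wave_limits) auto
  then have "\<forall>\<^sub>F x in at_top. dist ((exp (\<phi> x) - n x) / \<epsilon>) 0 < e / 4"
    using \<open>e > 0\<close> by (intro tendstoD) auto
  moreover have "\<forall>\<^sub>F x in at_top. dist (\<phi> x) 0 < e / 4"
    using \<open>e > 0\<close> wave_limits(3) by (intro tendstoD) auto
  ultimately have "\<forall>\<^sub>F x in at_top. \<bar>\<phi> x\<bar> \<le> e / 4 \<and> \<bar>(exp (\<phi> x) - n x) / \<epsilon>\<bar> \<le> e / 4"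
    by eventually_elim (simp only: dist_real_def, simp)
  then obtain N where N: "\<And>x. x \<ge> N \<Longrightarrow> \<bar>\<phi> x\<bar> \<le> e / 4 \<and> \<bar>(exp (\<phi> x) - n x) / \<epsilon>\<bar> \<le> e / 4"
    by (auto simp: eventually_at_top_linorder)
  have "dist (deriv \<phi> x) 0 < e" if "x \<ge> N" for x
  proof -
    have "\<bar>deriv \<phi> x\<bar> \<le> 2 * (e / 4) + e / 4"
      by (rule deriv_bound_interpolation[OF wave_smooth(3,4)]) (use N that in auto)
    then show ?thesis using \<open>e > 0\<close> by (simp add: dist_real_def)
  qed
  then show "\<forall>\<^sub>F x in at_top. dist (deriv \<phi> x) 0 < e"
    by (auto simp: eventually_at_top_linorder)
qed

text \<open>The second derivative of \<psi> in two forms: one directly in terms of \<open>v\<close>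
  and \<psi> for the regularity bootstrap, the other with the KdV right-hand side isolated for the
  energy and the comparison.\<close>

lemma wave_scaled:
  defines "v \<equiv> \<lambda>x. (n x - 1) / \<epsilon>" and "\<psi> \<equiv> \<lambda>x. \<phi> x / \<epsilon>"
  shows "\<psi> x = v x + \<epsilon> * potential_shift V \<gamma> \<epsilon> (v x)"
    "(exp (\<phi> x) - n x) / \<epsilon> / \<epsilon> =
      potential_shift V \<gamma> \<epsilon> (v x) + (1/2) * (\<psi> x)\<^sup>2 + \<epsilon> * exp_remainder \<epsilon> (\<psi> x)"
    "(exp (\<phi> x) - n x) / \<epsilon> / \<epsilon> =
      (2 * V * \<gamma>) * \<psi> x - V\<^sup>2 * (\<psi> x)\<^sup>2 + \<epsilon> * ode_remainder V \<gamma> \<epsilon> (v x) (\<psi> x)"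
proof -
  have nv: "n x = 1 + \<epsilon> * v x" and \<phi>\<psi>: "\<phi> x = \<epsilon> * \<psi> x" and v: "v x \<ge> 0"
    using \<epsilon> n_gt_1[of x] by (auto simp: v_def \<psi>_def)
  have "\<sigma> = V\<^sup>2 - 1" using \<sigma> by (simp add: V)
  then have "\<epsilon> * \<psi> x = \<epsilon> * (v x + \<epsilon> * potential_shift V \<gamma> \<epsilon> (v x))"
    using potential_eq[of x] potential_expansion[OF \<epsilon> v, of V \<gamma>] by (simp add: nv \<phi>\<psi> c)
  then show 1: "\<psi> x = v x + \<epsilon> * potential_shift V \<gamma> \<epsilon> (v x)" using \<epsilon> by simp
  show "(exp (\<phi> x) - n x) / \<epsilon> / \<epsilon> =
      potential_shift V \<gamma> \<epsilon> (v x) + (1/2) * (\<psi> x)\<^sup>2 + \<epsilon> * exp_remainder \<epsilon> (\<psi> x)"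
    using poisson_expansion(1)[OF \<epsilon> 1] by (simp add: nv \<phi>\<psi> power2_eq_square)
  then show "(exp (\<phi> x) - n x) / \<epsilon> / \<epsilon> =
      (2 * V * \<gamma>) * \<psi> x - V\<^sup>2 * (\<psi> x)\<^sup>2 + \<epsilon> * ode_remainder V \<gamma> \<epsilon> (v x) (\<psi> x)"
    using poisson_expansion(2)[OF \<epsilon> 1] by simp
qed

text \<open>The first integral rules out large amplitudes: were \<open>n\<close> to cross the level \<open>1 + K \<epsilon>\<close>,
  the kinetic part \<open>(\<psi>')\<^sup>2\<close> of the energy would be negative there.\<close>

lemma wave_energy:
  assumes C: "C > 0"
    "\<forall>v \<psi>. 0 \<le> v \<and> v \<le> 13 * \<gamma> / V \<and> \<psi> = v + \<epsilon> * potential_shift V \<gamma> \<epsilon> v \<longrightarrow>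
      v / 2 \<le> \<psi> \<and> \<psi> \<le> 2 * v \<and> \<bar>ode_remainder V \<gamma> \<epsilon> v \<psi>\<bar> \<le> C * \<psi>"
    and small: "C * \<epsilon> \<le> 2 * V * \<gamma>"
  defines "v \<equiv> \<lambda>x. (n x - 1) / \<epsilon>" and "\<psi> \<equiv> \<lambda>x. \<phi> x / \<epsilon>"
  shows "v x \<le> 13 * \<gamma> / V" and "v x \<le> 2 * \<psi> x"
    and "\<bar>(exp (\<phi> x) - n x) / \<epsilon> / \<epsilon> - ((2 * V * \<gamma>) * \<psi> x - V\<^sup>2 * (\<psi> x)\<^sup>2)\<bar> \<le> C * \<epsilon> * \<psi> x"
    and "x \<ge> 0 \<Longrightarrow> \<bar>(deriv \<phi> x / \<epsilon>)\<^sup>2 - ((2 * V * \<gamma>) * (\<psi> x)\<^sup>2 - 2/3 * V\<^sup>2 * (\<psi> x) ^ 3)\<bar> \<le> C * \<epsilon> * (\<psi> x)\<^sup>2"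
proof -
  have Vpos: "V > 0" using \<sigma> by (simp add: V)
  define K where "K = 13 * \<gamma> / V"
  have v0: "v x > 0" and \<psi>0: "\<psi> x > 0" for x
    using n_gt_1[of x] phi_pos[of x] \<epsilon> by (auto simp: v_def \<psi>_def)
  have bds: "v x / 2 \<le> \<psi> x" "\<bar>ode_remainder V \<gamma> \<epsilon> (v x) (\<psi> x)\<bar> \<le> C * \<psi> x" if "v x \<le> K" for x
    using C(2)[rule_format, of "v x" "\<psi> x"] v0[of x] that wave_scaled(1)[of x] by (auto simp: K_def v_def \<psi>_def)
  have ode: "\<bar>(exp (\<phi> x) - n x) / \<epsilon> / \<epsilon> - ((2 * V * \<gamma>) * \<psi> x - V\<^sup>2 * (\<psi> x)\<^sup>2)\<bar> \<le> C * \<epsilon> * \<psi> x"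
    if "v x \<le> K" for x
  proof -
    have "(exp (\<phi> x) - n x) / \<epsilon> / \<epsilon> - ((2 * V * \<gamma>) * \<psi> x - V\<^sup>2 * (\<psi> x)\<^sup>2)
        = \<epsilon> * ode_remainder V \<gamma> \<epsilon> (v x) (\<psi> x)"
      using wave_scaled(3)[of x] by (simp add: v_def \<psi>_def)
    then show ?thesis using mult_left_mono[OF bds(2)[OF that], of \<epsilon>] \<epsilon> by (simp add: abs_mult mult_ac)
  qed
  have vmono: "v y \<le> v x" if "0 \<le> x" "x \<le> y" for x y
    using n_nonincreasing[OF that] \<epsilon> by (simp add: v_def divide_right_mono)
  \<comment> \<open>By monotonicity, \<open>v x1 \<le> K\<close> propagates to all points right of
    \<open>x1\<close>, so the approximate equation holds on the whole half-line over which the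
    energy is integrated.\<close>
  have energy: "\<bar>(deriv \<phi> x1 / \<epsilon>)\<^sup>2 - ((2 * V * \<gamma>) * (\<psi> x1)\<^sup>2 - 2/3 * V\<^sup>2 * (\<psi> x1) ^ 3)\<bar> \<le> C * \<epsilon> * (\<psi> x1)\<^sup>2"
    if "x1 \<ge> 0" "v x1 \<le> K" for x1
  proof (rule energy_estimate[where \<psi> = \<psi> and \<psi>' = "\<lambda>x. deriv \<phi> x / \<epsilon>"
        and \<psi>'' = "\<lambda>x. (exp (\<phi> x) - n x) / \<epsilon> / \<epsilon>"])
    show "(\<psi> has_real_derivative deriv \<phi> x / \<epsilon>) (at x)" for x
      unfolding \<psi>_def by (intro DERIV_cdivide wave_smooth)
    show "((\<lambda>x. deriv \<phi> x / \<epsilon>) has_real_derivative (exp (\<phi> x) - n x) / \<epsilon> / \<epsilon>) (at x)" for x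
      by (intro DERIV_cdivide wave_smooth)
    show "deriv \<phi> x / \<epsilon> \<le> 0" if "x \<ge> x1" for x
      using wave_decreasing(2)[of x] deriv_phi_0 that \<open>x1 \<ge> 0\<close> \<epsilon>
      by (cases "x = 0") (auto simp: divide_nonpos_pos)
    show "\<bar>(exp (\<phi> x) - n x) / \<epsilon> / \<epsilon> - ((2 * V * \<gamma>) * \<psi> x - V\<^sup>2 * (\<psi> x)\<^sup>2)\<bar> \<le> C * \<epsilon> * \<psi> x"
      if "x \<ge> x1" for x
      using ode[of x] vmono[of x1 x] that \<open>x1 \<ge> 0\<close> \<open>v x1 \<le> K\<close> by linarith
    show "(\<psi> \<longlongrightarrow> 0) at_top"
      unfolding \<psi>_def using tendsto_divide[OF wave_limits(3) tendsto_const, of \<epsilon>] \<epsilon> by simp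
    show "((\<lambda>x. deriv \<phi> x / \<epsilon>) \<longlongrightarrow> 0) at_top"
      using tendsto_divide[OF deriv_phi_tendsto tendsto_const, of \<epsilon>] \<epsilon> by simp
  qed
  have "v 0 \<le> K"
  proof (rule ccontr)
    assume "\<not> v 0 \<le> K"
    then have big: "v 0 > K" by simp
    have K: "K > 0" using \<gamma> Vpos by (simp add: K_def)
    have "(v \<longlongrightarrow> (1 - 1) / \<epsilon>) at_top"
      unfolding v_def using \<epsilon> by (intro tendsto_intros wave_limits) auto
    then have "\<forall>\<^sub>F x in at_top. v x < K" using K order_tendstoD(2) by fastforce
    then obtain X where X: "X \<ge> 0" "v X < K"
      by (metis eventually_at_top_linorder max.cobounded1 max.cobounded2)
    have "isCont v x" for x
      unfolding v_def using DERIV_isCont[OF wave_smooth(1)] \<epsilon> by (intro continuous_intros) auto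
    then have "\<exists>x\<ge>0. x \<le> X \<and> v x = K"
      using X big by (intro IVT2) auto
    then obtain x where x: "x \<ge> 0" "v x = K" by auto
    have "0 \<le> (deriv \<phi> x / \<epsilon>)\<^sup>2" by simp
    also have "\<dots> \<le> (2 * V * \<gamma>) * (\<psi> x)\<^sup>2 - 2/3 * V\<^sup>2 * (\<psi> x) ^ 3 + C * \<epsilon> * (\<psi> x)\<^sup>2"
      using energy[of x] x by (simp add: abs_le_iff)
    also have "\<dots> = (\<psi> x)\<^sup>2 * (2 * V * \<gamma> + C * \<epsilon> - 2/3 * V\<^sup>2 * \<psi> x)"
      by (simp add: algebra_simps eval_nat_numeral)
    finally have "2/3 * V\<^sup>2 * \<psi> x \<le> 2 * V * \<gamma> + C * \<epsilon>"
      using \<psi>0[of x] by (simp add: zero_le_mult_iff)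
    moreover have "2/3 * V\<^sup>2 * (K / 2) \<le> 2/3 * V\<^sup>2 * \<psi> x"
      using bds(1)[of x] x by (intro mult_left_mono) auto
    \<comment> \<open>The constant 13 is chosen here: \<open>small\<close> bounds the energy side by
      4 V \<gamma>, and 13/3 exceeds 4, whereas 12 would give equality.\<close>
    moreover have "2/3 * V\<^sup>2 * (K / 2) = 13/3 * (V * \<gamma>)"
      using Vpos by (simp add: K_def power2_eq_square)
    ultimately show False using small mult_pos_pos[OF Vpos \<gamma>] by simp
  qed
  then have vK: "v x \<le> K" for x
    using vmono[of 0 x] vmono[of 0 "- x"] wave_even(1)[of x] by (cases "x \<ge> 0") (auto simp: v_def)
  then show "v x \<le> 13 * \<gamma> / V" by (simp add: K_def)
  show "v x \<le> 2 * \<psi> x" using bds(1)[OF vK, of x] by simp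
  show "\<bar>(exp (\<phi> x) - n x) / \<epsilon> / \<epsilon> - ((2 * V * \<gamma>) * \<psi> x - V\<^sup>2 * (\<psi> x)\<^sup>2)\<bar> \<le> C * \<epsilon> * \<psi> x"
    using ode vK by blast
  show "\<bar>(deriv \<phi> x / \<epsilon>)\<^sup>2 - ((2 * V * \<gamma>) * (\<psi> x)\<^sup>2 - 2/3 * V\<^sup>2 * (\<psi> x) ^ 3)\<bar> \<le> C * \<epsilon> * (\<psi> x)\<^sup>2"
    if "x \<ge> 0" using energy vK that by blast
qed

end

section \<open>Uniform comparison of solitary waves with the KdV profile\<close>

text \<open>The half-angle identity for cosh turns the squared sech into the reciprocal of a
  solution of a linear equation.\<close>

lemma n_KdV_alt:
  assumes "\<sigma> \<ge> 0" "\<gamma> > 0" and V: "V = sqrt (1 + \<sigma>)"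
  shows "n_KdV \<sigma> \<gamma> x = 6 * \<gamma> / V / (1 + cosh (sqrt (2 * V * \<gamma>) * x))"
proof -
  have Vpos: "V > 0" using assms by simp
  define a where "a = sqrt (V * \<gamma> / 2)"
  have "sqrt (2 * V * \<gamma>) = sqrt (2\<^sup>2 * (V * \<gamma> / 2))" by simp
  also have "\<dots> = 2 * a" unfolding real_sqrt_mult a_def by simp
  finally have \<kappa>: "sqrt (2 * V * \<gamma>) * x = 2 * (a * x)" by simp
  have "1 + cosh (2 * (a * x)) = 2 * (cosh (a * x))\<^sup>2" by (simp add: cosh_double_cosh)
  then show ?thesis
    unfolding \<kappa> using Vpos by (simp add: n_KdV_def sech_def V[symmetric] a_def[symmetric] power_divide)
qed

lemma solitary_wave_estimate:
  fixes \<sigma> \<gamma> V :: real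
  assumes "\<sigma> \<ge> 0" "\<gamma> > 0" and V: "V = sqrt (1 + \<sigma>)"
  obtains \<epsilon>1 C where "0 < \<epsilon>1" "\<epsilon>1 \<le> 1" "C > 0"
    "\<And>\<epsilon> n u \<phi> x. \<lbrakk>0 < \<epsilon>; \<epsilon> < \<epsilon>1; solitary_wave \<sigma> \<gamma> \<epsilon> n u \<phi>\<rbrakk> \<Longrightarrow>
      (n x - 1) / \<epsilon> \<le> 13 * \<gamma> / V \<and>
      (n x - 1) / \<epsilon> \<le> C * exp (- (sqrt (2 * V * \<gamma>) / 2) * \<bar>x\<bar>) \<and>
      \<phi> x / \<epsilon> \<le> C * exp (- (sqrt (2 * V * \<gamma>) / 2) * \<bar>x\<bar>) \<and>
      \<bar>\<phi> x / \<epsilon> - n_KdV \<sigma> \<gamma> x\<bar> \<le> C * (\<epsilon> * exp (- (sqrt (2 * V * \<gamma>) / 2) * \<bar>x\<bar>))"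
proof -
  have Vpos: "V > 0" using assms by simp
  define \<kappa> where "\<kappa> = sqrt (2 * V * \<gamma>)"
  have \<kappa>2: "\<kappa>\<^sup>2 = 2 * V * \<gamma>" using Vpos assms by (simp add: \<kappa>_def)
  have "13 * \<gamma> / V > 0" using Vpos assms by simp
  then obtain \<epsilon>0 C1 where \<epsilon>0: "0 < \<epsilon>0" "\<epsilon>0 \<le> 1" and C1: "C1 > 0"
    "\<And>\<epsilon> v \<psi>. \<lbrakk>0 < \<epsilon>; \<epsilon> \<le> \<epsilon>0; 0 \<le> v; v \<le> 13 * \<gamma> / V; \<psi> = v + \<epsilon> * potential_shift V \<gamma> \<epsilon> v\<rbrakk> \<Longrightarrow>
      v / 2 \<le> \<psi> \<and> \<psi> \<le> 2 * v \<and> \<bar>ode_remainder V \<gamma> \<epsilon> v \<psi>\<bar> \<le> C1 * \<psi>"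
    by (rule expansion_uniform[where V = V and \<gamma> = \<gamma>]) blast
  \<comment> \<open>The summand 1 covers the equation and the energy;
    \<open>3 / (2 * V\<^sup>2)\<close> is the factor by which the energy error is multiplied when it
    is solved for the amplitude.\<close>
  define C0 where "C0 = C1 * (1 + 3 / (2 * V\<^sup>2))"
  have C0: "C0 > 0" "C1 \<le> C0" "3 / (2 * V\<^sup>2) * C1 \<le> C0"
    using C1 Vpos by (auto simp: C0_def algebra_simps intro!: add_pos_pos)
  obtain \<epsilon>2 C where \<epsilon>2: "\<epsilon>2 > 0" and C: "C > 0"
    "\<And>\<epsilon> \<psi> \<psi>' \<psi>'' x. \<lbrakk>0 < \<epsilon>; \<epsilon> < \<epsilon>2;
      \<And>x. (\<psi> has_real_derivative \<psi>' x) (at x);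
      \<And>x. (\<psi>' has_real_derivative \<psi>'' x) (at x);
      \<And>x. \<psi> x > 0; \<psi>' 0 = 0; \<bar>\<psi> 0 - 3 * \<gamma> / V\<bar> \<le> C0 * \<epsilon>;
      \<And>x. x \<ge> 0 \<Longrightarrow> \<bar>\<psi>'' x - (\<kappa>\<^sup>2 * \<psi> x - V\<^sup>2 * (\<psi> x)\<^sup>2)\<bar> \<le> C0 * \<epsilon> * \<psi> x;
      \<And>x. x \<ge> 0 \<Longrightarrow> \<bar>(\<psi>' x)\<^sup>2 - (\<kappa>\<^sup>2 * (\<psi> x)\<^sup>2 - 2/3 * V\<^sup>2 * (\<psi> x) ^ 3)\<bar> \<le> C0 * \<epsilon> * (\<psi> x)\<^sup>2;
      x \<ge> 0\<rbrakk> \<Longrightarrow> \<psi> x \<le> C * exp (- (\<kappa> / 2) * x) \<and>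
        \<bar>\<psi> x - 6 * \<gamma> / V / (1 + cosh (\<kappa> * x))\<bar> \<le> C * (\<epsilon> * exp (- (\<kappa> / 2) * x))"
    unfolding \<kappa>_def by (rule profile_estimate[OF Vpos assms(2) C0(1)]) blast
  define \<epsilon>1 where "\<epsilon>1 = min \<epsilon>0 (min \<epsilon>2 (2 * V * \<gamma> / C1))"
  show ?thesis
  proof
    \<comment> \<open>The constant is doubled because \<open>(n x - 1) / \<epsilon>\<close> is
      bounded only by twice the scaled potential.\<close>
    show "0 < \<epsilon>1" "\<epsilon>1 \<le> 1" "2 * C > 0" using \<epsilon>0 \<epsilon>2 C1 Vpos assms C by (auto simp: \<epsilon>1_def)
    fix \<epsilon> n u \<phi> x
    assume \<epsilon>: "0 < \<epsilon>" "\<epsilon> < \<epsilon>1" and wave: "solitary_wave \<sigma> \<gamma> \<epsilon> n u \<phi>"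
    note facts = assms(1,2) \<epsilon>(1) wave V refl
    have \<epsilon>': "\<epsilon> \<le> \<epsilon>0" "\<epsilon> < \<epsilon>2" "C1 * \<epsilon> \<le> 2 * V * \<gamma>"
    proof -
      show "\<epsilon> \<le> \<epsilon>0" "\<epsilon> < \<epsilon>2" using \<epsilon> by (auto simp: \<epsilon>1_def)
      have "\<epsilon> \<le> 2 * V * \<gamma> / C1" using \<epsilon> by (auto simp: \<epsilon>1_def)
      then show "C1 * \<epsilon> \<le> 2 * V * \<gamma>" using C1(1) by (simp add: field_simps)
    qed
    have C1\<epsilon>: "\<forall>v \<psi>. 0 \<le> v \<and> v \<le> 13 * \<gamma> / V \<and> \<psi> = v + \<epsilon> * potential_shift V \<gamma> \<epsilon> v \<longrightarrow>
        v / 2 \<le> \<psi> \<and> \<psi> \<le> 2 * v \<and> \<bar>ode_remainder V \<gamma> \<epsilon> v \<psi>\<bar> \<le> C1 * \<psi>"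
      using C1(2)[OF \<epsilon>(1) \<epsilon>'(1)] by blast
    note en = wave_energy[OF facts C1(1) C1\<epsilon> \<epsilon>'(3)]
    define \<psi> where "\<psi> = (\<lambda>x. \<phi> x / \<epsilon>)"
    have \<psi>: "(\<psi> has_real_derivative deriv \<phi> x / \<epsilon>) (at x)" for x
      unfolding \<psi>_def by (intro DERIV_cdivide wave_smooth[OF facts])
    have \<psi>': "((\<lambda>x. deriv \<phi> x / \<epsilon>) has_real_derivative (exp (\<phi> x) - n x) / \<epsilon> / \<epsilon>) (at x)" for x
      by (intro DERIV_cdivide wave_smooth[OF facts])
    have pos: "\<psi> x > 0" for x using phi_pos[OF facts, of x] \<epsilon> by (simp add: \<psi>_def)
    have crit: "deriv \<phi> 0 / \<epsilon> = 0" using deriv_phi_0[OF facts] by simp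
    have weaken: "C1 * \<epsilon> * t \<le> C0 * \<epsilon> * t" if "t \<ge> 0" for t
      using C0 \<epsilon> that by (intro mult_right_mono) auto
    have ode: "\<bar>(exp (\<phi> x) - n x) / \<epsilon> / \<epsilon> - (\<kappa>\<^sup>2 * \<psi> x - V\<^sup>2 * (\<psi> x)\<^sup>2)\<bar> \<le> C0 * \<epsilon> * \<psi> x" for x
      using en(3)[of x] weaken[of "\<psi> x"] pos[of x] unfolding \<kappa>2 \<psi>_def by linarith
    have energy: "\<bar>(deriv \<phi> x / \<epsilon>)\<^sup>2 - (\<kappa>\<^sup>2 * (\<psi> x)\<^sup>2 - 2/3 * V\<^sup>2 * (\<psi> x) ^ 3)\<bar> \<le> C0 * \<epsilon> * (\<psi> x)\<^sup>2"
      if "x \<ge> 0" for x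
      using en(4)[OF that] weaken[of "(\<psi> x)\<^sup>2"] unfolding \<kappa>2 \<psi>_def by (meson order_trans zero_le_power2)
    \<comment> \<open>At the crest the slope vanishes, and the energy polynomial factors as (\<psi>
      0)^2 times a multiple of \<psi> 0 - 3 \<gamma>/V. Cancelling the square gives the amplitude up
      to O(\<epsilon>).\<close>
    have init: "\<bar>\<psi> 0 - 3 * \<gamma> / V\<bar> \<le> C0 * \<epsilon>"
    proof -
      have "\<bar>\<kappa>\<^sup>2 * (\<psi> 0)\<^sup>2 - 2/3 * V\<^sup>2 * (\<psi> 0) ^ 3\<bar> \<le> C1 * \<epsilon> * (\<psi> 0)\<^sup>2"
        using en(4)[of 0] deriv_phi_0[OF facts] unfolding \<kappa>2 \<psi>_def by simp
      moreover have "\<kappa>\<^sup>2 * (\<psi> 0)\<^sup>2 - 2/3 * V\<^sup>2 * (\<psi> 0) ^ 3 = - (2/3 * V\<^sup>2 * (\<psi> 0)\<^sup>2) * (\<psi> 0 - 3 * \<gamma> / V)"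
        using Vpos unfolding \<kappa>2 by (simp add: field_simps eval_nat_numeral)
      ultimately have "(2/3 * V\<^sup>2 * \<bar>\<psi> 0 - 3 * \<gamma> / V\<bar>) * (\<psi> 0)\<^sup>2 \<le> (C1 * \<epsilon>) * (\<psi> 0)\<^sup>2"
        by (simp add: abs_mult mult_ac)
      then have "2/3 * V\<^sup>2 * \<bar>\<psi> 0 - 3 * \<gamma> / V\<bar> \<le> C1 * \<epsilon>"
        by (rule mult_right_le_imp_le) (use pos[of 0] in simp)
      then have "\<bar>\<psi> 0 - 3 * \<gamma> / V\<bar> \<le> 3 / (2 * V\<^sup>2) * C1 * \<epsilon>"
        using Vpos by (simp add: field_simps)
      also have "\<dots> \<le> C0 * \<epsilon>" using C0(3) \<epsilon> by (intro mult_right_mono) auto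
      finally show ?thesis .
    qed
    have est: "\<psi> x \<le> C * exp (- (\<kappa> / 2) * x) \<and>
        \<bar>\<psi> x - n_KdV \<sigma> \<gamma> x\<bar> \<le> C * (\<epsilon> * exp (- (\<kappa> / 2) * x))" if "x \<ge> 0" for x
      unfolding n_KdV_alt[OF assms] \<kappa>_def[symmetric]
      by (rule C(2)[OF \<epsilon>(1) \<epsilon>'(2) \<psi> \<psi>' pos crit init ode energy that])
    have "\<psi> \<bar>x\<bar> = \<psi> x" "n_KdV \<sigma> \<gamma> \<bar>x\<bar> = n_KdV \<sigma> \<gamma> x"
      using wave_even(2)[OF facts, of x] by (auto simp: \<psi>_def abs_if n_KdV_alt[OF assms])
    then have est': "\<psi> x \<le> C * exp (- (\<kappa> / 2) * \<bar>x\<bar>)"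
      "\<bar>\<psi> x - n_KdV \<sigma> \<gamma> x\<bar> \<le> C * (\<epsilon> * exp (- (\<kappa> / 2) * \<bar>x\<bar>))"
      using est[of "\<bar>x\<bar>"] by auto
    have dbl: "C * t \<le> 2 * C * t" if "t \<ge> 0" for t
      using C(1) that by simp
    have "\<psi> x \<le> 2 * C * exp (- (\<kappa> / 2) * \<bar>x\<bar>)"
      by (rule order_trans[OF est'(1) dbl]) simp
    moreover have "\<bar>\<psi> x - n_KdV \<sigma> \<gamma> x\<bar> \<le> 2 * C * (\<epsilon> * exp (- (\<kappa> / 2) * \<bar>x\<bar>))"
      by (rule order_trans[OF est'(2) dbl]) (use \<epsilon> in simp)
    moreover have "(n x - 1) / \<epsilon> \<le> 2 * C * exp (- (\<kappa> / 2) * \<bar>x\<bar>)"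
      using en(2)[of x] est'(1) by (simp add: \<psi>_def)
    ultimately show "(n x - 1) / \<epsilon> \<le> 13 * \<gamma> / V \<and>
      (n x - 1) / \<epsilon> \<le> 2 * C * exp (- (sqrt (2 * V * \<gamma>) / 2) * \<bar>x\<bar>) \<and>
      \<phi> x / \<epsilon> \<le> 2 * C * exp (- (sqrt (2 * V * \<gamma>) / 2) * \<bar>x\<bar>) \<and>
      \<bar>\<phi> x / \<epsilon> - n_KdV \<sigma> \<gamma> x\<bar> \<le> 2 * C * (\<epsilon> * exp (- (sqrt (2 * V * \<gamma>) / 2) * \<bar>x\<bar>))"
      using en(1)[of x] by (simp add: \<psi>_def \<kappa>_def)
  qed
qed

section \<open>Derivatives of all orders\<close>

text \<open>With y = \<eta> (1 + cosh (\<kappa> x)) and V^2 = 3 \<eta> \<kappa>^2, the identity for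
  the square of sinh reduces 2 y'^2 - y y'' to (\<kappa>^2 y - V^2) y; division by y^3 gives the KdV
  profile equation for 1/y.\<close>

lemma n_KdV_ode:
  fixes \<sigma> \<gamma> V :: real
  assumes "\<sigma> \<ge> 0" "\<gamma> > 0" and V: "V = sqrt (1 + \<sigma>)"
  obtains Q' where "\<And>x. (n_KdV \<sigma> \<gamma> has_real_derivative Q' x) (at x)"
    "\<And>x. (Q' has_real_derivative (2 * V * \<gamma>) * n_KdV \<sigma> \<gamma> x - V\<^sup>2 * (n_KdV \<sigma> \<gamma> x)\<^sup>2) (at x)"
proof -
  have Vpos: "V > 0" using assms by simp
  define \<kappa> where "\<kappa> = sqrt (2 * V * \<gamma>)"
  have \<kappa>2: "\<kappa>\<^sup>2 = 2 * V * \<gamma>" using Vpos assms by (simp add: \<kappa>_def)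
  define \<eta> where "\<eta> = V / (6 * \<gamma>)"
  have \<eta>: "\<eta> > 0" "V\<^sup>2 = 3 * \<eta> * \<kappa>\<^sup>2"
    unfolding \<kappa>2 \<eta>_def using Vpos assms(2) by (auto simp: power2_eq_square)
  define y where "y = (\<lambda>x. \<eta> * (1 + cosh (\<kappa> * x)))"
  define y' where "y' = (\<lambda>x. \<eta> * (\<kappa> * sinh (\<kappa> * x)))"
  define y'' where "y'' = (\<lambda>x. \<eta> * (\<kappa>\<^sup>2 * cosh (\<kappa> * x)))"
  have y: "(y has_real_derivative y' x) (at x)" for x
    unfolding y_def y'_def using DERIV_add[OF DERIV_const cosh_has_derivs(1)]
    by (intro DERIV_cmult) fastforce
  have y': "(y' has_real_derivative y'' x) (at x)" for x
    unfolding y'_def y''_def by (intro DERIV_cmult cosh_has_derivs)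
  have pos: "y x > 0" for x using \<eta> by (simp add: y_def add_pos_pos)
  have Q: "n_KdV \<sigma> \<gamma> = (\<lambda>x. 1 / y x)"
    using Vpos assms by (auto simp: n_KdV_alt[OF assms] y_def \<eta>_def \<kappa>_def)
  have eq: "2 * (y' x)\<^sup>2 / (y x) ^ 3 - y'' x / (y x)\<^sup>2
      = (2 * V * \<gamma>) * n_KdV \<sigma> \<gamma> x - V\<^sup>2 * (n_KdV \<sigma> \<gamma> x)\<^sup>2" for x
  proof -
    define C where "C = cosh (\<kappa> * x)"
    have yC: "y x = \<eta> * (1 + C)" by (simp add: y_def C_def)
    have nz: "y x \<noteq> 0" using pos[of x] by simp
    have "2 * (y' x)\<^sup>2 - y'' x * y x = \<eta>\<^sup>2 * \<kappa>\<^sup>2 * (2 * (sinh (\<kappa> * x))\<^sup>2 - C * (1 + C))"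
      by (simp add: y'_def y''_def yC C_def[symmetric] algebra_simps power2_eq_square)
    also have "\<dots> = \<eta>\<^sup>2 * \<kappa>\<^sup>2 * ((1 + C) * (C - 2))"
      by (simp add: sinh_square_eq C_def[symmetric]) (simp add: algebra_simps power2_eq_square)
    also have "\<dots> = (\<kappa>\<^sup>2 * y x - V\<^sup>2) * y x"
      unfolding \<eta>(2) yC by (simp add: algebra_simps power2_eq_square)
    finally have "2 * (y' x)\<^sup>2 - y'' x * y x = (\<kappa>\<^sup>2 * y x - V\<^sup>2) * y x" .
    then have "(2 * (y' x)\<^sup>2 - y'' x * y x) / y x ^ 3 = (\<kappa>\<^sup>2 * y x - V\<^sup>2) * y x / y x ^ 3" by simp
    then show ?thesis
      unfolding Q \<kappa>2[symmetric] using nz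
      by (simp add: diff_divide_distrib left_diff_distrib eval_nat_numeral)
  qed
  show ?thesis
  proof (rule that)
    show "(n_KdV \<sigma> \<gamma> has_real_derivative - y' x / (y x)\<^sup>2) (at x)" for x
      unfolding Q by (rule reciprocal_ode(1)[OF y y' pos])
    show "((\<lambda>x. - y' x / (y x)\<^sup>2) has_real_derivative
        (2 * V * \<gamma>) * n_KdV \<sigma> \<gamma> x - V\<^sup>2 * (n_KdV \<sigma> \<gamma> x)\<^sup>2) (at x)" for x
      unfolding eq[symmetric] by (rule reciprocal_ode(2)[OF y y' pos])
  qed
qed

section \<open>Regularity bootstrap for a uniform family of solitary waves\<close>

context
  fixes \<sigma> \<gamma> V \<beta> C :: real and S :: "'s set" and e :: "'s \<Rightarrow> real"
    and n u \<phi> v \<psi> w :: "'s \<Rightarrow> real \<Rightarrow> real"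
  assumes \<sigma>: "\<sigma> \<ge> 0" and \<gamma>: "\<gamma> > 0" and V: "V = sqrt (1 + \<sigma>)" and \<beta>: "\<beta> \<ge> 0" and C: "C > 0"
    and e: "\<And>s. s \<in> S \<Longrightarrow> 0 < e s \<and> e s \<le> 1"
    and wave: "\<And>s. s \<in> S \<Longrightarrow> solitary_wave \<sigma> \<gamma> (e s) (n s) (u s) (\<phi> s)"
    and small: "\<And>s x. s \<in> S \<Longrightarrow> \<sigma> * (n s x)\<^sup>2 \<le> V\<^sup>2 - 1/2"
    and decay: "\<And>s x. s \<in> S \<Longrightarrow> (n s x - 1) / e s \<le> C * exp (- \<beta> * \<bar>x\<bar>)"
      "\<And>s x. s \<in> S \<Longrightarrow> \<phi> s x / e s \<le> C * exp (- \<beta> * \<bar>x\<bar>)"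
    and close: "\<And>s x. s \<in> S \<Longrightarrow> \<bar>\<phi> s x / e s - n_KdV \<sigma> \<gamma> x\<bar> \<le> C * (e s * exp (- \<beta> * \<bar>x\<bar>))"
  defines "v \<equiv> \<lambda>s x. (n s x - 1) / e s"
    and "\<psi> \<equiv> \<lambda>s x. \<phi> s x / e s"
    and "w \<equiv> \<lambda>s x. exp (- \<beta> * \<bar>x\<bar>)"
begin

lemma family_facts:
  assumes "s \<in> S"
  shows "\<sigma> \<ge> 0" "\<gamma> > 0" "e s > 0" "solitary_wave \<sigma> \<gamma> (e s) (n s) (u s) (\<phi> s)"
    "V = sqrt (1 + \<sigma>)" "V + \<gamma> * e s = V + \<gamma> * e s"
  using \<sigma> \<gamma> e[OF assms] wave[OF assms] V by auto

lemma weight_bounds: "0 \<le> w s x \<and> w s x \<le> 1" "0 \<le> w s x"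
  using \<beta> by (auto simp: w_def)

lemma v_nonneg: "s \<in> S \<Longrightarrow> v s x \<ge> 0"
proof -
  assume s: "s \<in> S"
  show ?thesis using n_gt_1[OF family_facts[OF s], of x] e[OF s] by (simp add: v_def)
qed

lemma psi_nonneg: "s \<in> S \<Longrightarrow> \<psi> s x \<ge> 0"
proof -
  assume s: "s \<in> S"
  show ?thesis using phi_pos[OF family_facts[OF s], of x] e[OF s] by (simp add: \<psi>_def)
qed

lemma n_v: "s \<in> S \<Longrightarrow> n s x = 1 + e s * v s x"
  using e[of s] by (simp add: v_def)

lemma scaled_derivs:
  assumes "s \<in> S"
  shows "(v s has_real_derivative deriv (n s) x / e s) (at x)"
    "(\<psi> s has_real_derivative deriv (\<phi> s) x / e s) (at x)"
    "((\<lambda>x. deriv (\<phi> s) x / e s) has_real_derivative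
      potential_shift V \<gamma> (e s) (v s x) + (1/2) * (\<psi> s x)\<^sup>2 + e s * exp_remainder (e s) (\<psi> s x)) (at x)"
proof -
  have "((\<lambda>x. n s x - 1) has_real_derivative deriv (n s) x - 0) (at x)"
    by (intro DERIV_diff wave_smooth[OF family_facts[OF assms]] DERIV_const)
  then show "(v s has_real_derivative deriv (n s) x / e s) (at x)"
    unfolding v_def[abs_def] using DERIV_cdivide by fastforce
  show "(\<psi> s has_real_derivative deriv (\<phi> s) x / e s) (at x)"
    unfolding \<psi>_def[abs_def] by (intro DERIV_cdivide wave_smooth[OF family_facts[OF assms]])
  show "((\<lambda>x. deriv (\<phi> s) x / e s) has_real_derivative
      potential_shift V \<gamma> (e s) (v s x) + (1/2) * (\<psi> s x)\<^sup>2 + e s * exp_remainder (e s) (\<psi> s x)) (at x)"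
    using DERIV_cdivide[OF wave_smooth(4)[OF family_facts[OF assms], of x], where c = "e s"]
    unfolding wave_scaled(2)[OF family_facts[OF assms]] v_def \<psi>_def .
qed

text \<open>The assumption \<open>small\<close> keeps
  \<open>(V + \<gamma> * e s)\<^sup>2 - \<sigma> * (n s x)\<^sup>2\<close> at least 1/2, so the
  derivative of \<phi> with respect to n is invertible and the slope of n is a smooth bounded
  multiple of that of \<phi>. This is how derivative bounds reach \<open>v\<close>, while \<psi>
  gets them from Poisson's equation.\<close>

lemma potential_slope:
  assumes "s \<in> S"
  shows "deriv (n s) x / e s = deriv (\<phi> s) x / e s *
    ((1 + e s * v s x) ^ 3 * (1 / ((V + \<gamma> * e s)\<^sup>2 - \<sigma> * (1 + e s * v s x)\<^sup>2)))"
    and "1/2 \<le> (V + \<gamma> * e s)\<^sup>2 - \<sigma> * (1 + e s * v s x)\<^sup>2"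
proof -
  define m c where "m = n s x" and "c = V + \<gamma> * e s"
  have m: "m = 1 + e s * v s x" using n_v[OF assms] by (simp add: m_def)
  have mpos: "m > 0" using n_gt_1[OF family_facts[OF assms], of x] by (simp add: m_def)
  have "V \<ge> 0" using \<sigma> by (simp add: V)
  then have "V\<^sup>2 \<le> c\<^sup>2" using \<gamma> e[OF assms] by (intro power_mono) (auto simp: c_def)
  then have D: "1/2 \<le> c\<^sup>2 - \<sigma> * m\<^sup>2" using small[OF assms, of x] by (simp add: m_def)
  then show "1/2 \<le> (V + \<gamma> * e s)\<^sup>2 - \<sigma> * (1 + e s * v s x)\<^sup>2" by (simp add: m c_def)
  define D where "D = c\<^sup>2 - \<sigma> * m\<^sup>2"
  have "D > 0" using \<open>1/2 \<le> c\<^sup>2 - \<sigma> * m\<^sup>2\<close> by (simp add: D_def)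
  have "c\<^sup>2 / m ^ 3 - \<sigma> / m = D / m ^ 3"
    using mpos by (simp add: D_def diff_divide_distrib eval_nat_numeral)
  then have "deriv (\<phi> s) x = D / m ^ 3 * deriv (n s) x"
    using deriv_phi_eq[OF family_facts[OF assms], of x] by (simp add: m_def c_def)
  then have "deriv (n s) x = deriv (\<phi> s) x * (m ^ 3 * (1 / D))"
    using mpos \<open>D > 0\<close> by simp
  then show "deriv (n s) x / e s = deriv (\<phi> s) x / e s *
    ((1 + e s * v s x) ^ 3 * (1 / ((V + \<gamma> * e s)\<^sup>2 - \<sigma> * (1 + e s * v s x)\<^sup>2)))"
    by (simp add: m[symmetric] c_def[symmetric] D_def[symmetric])
qed

lemma unit_weight: "bounded_derivs S w k f \<Longrightarrow> bounded_derivs S (\<lambda>_ _. 1) k f"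
  by (rule bounded_derivs_weaken[OF _ weight_bounds(1)])

lemma unit_param: "bounded_derivs S (\<lambda>_ _. 1) k (\<lambda>s x. e s)"
  by (rule bounded_derivs_param_unit[OF e])

lemma scaled_interpolation:
  assumes "bounded_derivs S w 0 \<psi>" "bounded_derivs S w k v" "bounded_derivs S w k \<psi>"
  shows "bounded_derivs S w (Suc (Suc k)) \<psi>"
proof -
  have "bounded_derivs S w k (\<lambda>s x. potential_shift V \<gamma> (e s) (v s x) + (1/2) * (\<psi> s x)\<^sup>2
      + e s * exp_remainder (e s) (\<psi> s x))"
  proof (intro bounded_derivs_add bounded_derivs_mult_left[where w = w] weight_bounds(2))
    show "bounded_derivs S w k (\<lambda>s x. potential_shift V \<gamma> (e s) (v s x))"
      by (rule bounded_derivs_expansion(2)[OF e weight_bounds(1) v_nonneg assms(2)])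
    show "bounded_derivs S w k (\<lambda>s x. exp_remainder (e s) (\<psi> s x))"
      by (rule bounded_derivs_exp_remainder[OF e weight_bounds(1) psi_nonneg assms(3)])
    show "bounded_derivs S w k (\<lambda>s x. (\<psi> s x)\<^sup>2)"
      by (rule bounded_derivs_power_Suc[OF assms(3) unit_weight[OF assms(3)] weight_bounds(2)]) simp
  qed (rule bounded_derivs_const unit_param)+
  then show ?thesis
    using bounded_derivs_interpolation[where a = "\<lambda>_. 1" and S = S, OF scaled_derivs(2,3) \<beta>, where k = k] assms(1)
    by (simp add: w_def[abs_def])
qed

lemma base_bounds: "bounded_derivs S w 0 v" "bounded_derivs S w 0 \<psi>"
proof -
  have "\<bar>v s x\<bar> \<le> C * w s x" "\<bar>\<psi> s x\<bar> \<le> C * w s x" if "s \<in> S" for s x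
    unfolding abs_of_nonneg[OF v_nonneg[OF that]] abs_of_nonneg[OF psi_nonneg[OF that]]
    unfolding v_def \<psi>_def w_def using decay[OF that] .
  then show "bounded_derivs S w 0 v" "bounded_derivs S w 0 \<psi>"
    unfolding bounded_derivs.simps by blast+
qed

text \<open>The induction keeps \<psi> one order ahead of \<open>v\<close>. The slope relation turns
  \<psi> at order k + 1 into \<open>v\<close> at order k + 1, and Poisson's equation then raises
  \<psi> by two orders, more than enough to restore the lead.\<close>

lemma scaled_bounds: "bounded_derivs S w k v \<and> bounded_derivs S w (Suc k) \<psi>"
proof (induction k)
  case 0
  show ?case using base_bounds scaled_interpolation bounded_derivs_Suc_le by blast
next
  case (Suc k)
  then have vk: "bounded_derivs S w k v" and \<psi>k: "bounded_derivs S w (Suc k) \<psi>" by auto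
  note v1 = unit_weight[OF vk]
  have n1: "bounded_derivs S (\<lambda>_ _. 1) k (\<lambda>s x. 1 + e s * v s x)"
    by (intro bounded_derivs_add bounded_derivs_mult_left bounded_derivs_const unit_param v1) auto
  have "bounded_derivs S w k (\<lambda>s x. deriv (\<phi> s) x / e s *
      ((1 + e s * v s x) ^ 3 * (1 / ((V + \<gamma> * e s)\<^sup>2 - \<sigma> * (1 + e s * v s x)\<^sup>2))))"
  proof (intro bounded_derivs_mult_right[where w = w] bounded_derivs_mult_left[where w = "\<lambda>_ _. 1"]
      bounded_derivs_inverse[where c = "1/2"] bounded_derivs_diff bounded_derivs_power n1 weight_bounds(2)
      potential_slope(2))
    show "bounded_derivs S w k (\<lambda>s x. deriv (\<phi> s) x / e s)"
      by (rule bounded_derivs_SucD[OF \<psi>k scaled_derivs(2)])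
    show "bounded_derivs S (\<lambda>_ _. 1) k (\<lambda>s x. V + \<gamma> * e s)"
      by (intro bounded_derivs_add bounded_derivs_mult_left bounded_derivs_const unit_param) auto
  qed (auto intro: bounded_derivs_const)
  then have dv: "bounded_derivs S w k (\<lambda>s x. deriv (n s) x / e s)"
    using bounded_derivs_cong[OF potential_slope(1)] by fastforce
  have vS: "bounded_derivs S w (Suc k) v"
    by (rule bounded_derivs_SucI[OF base_bounds(1) scaled_derivs(1) dv])
  show ?case
    using vS scaled_interpolation[OF base_bounds(2) vS \<psi>k] bounded_derivs_Suc_le by blast
qed

lemma v_bdd: "bounded_derivs S w k v" and psi_bdd: "bounded_derivs S w k \<psi>"
  using scaled_bounds bounded_derivs_Suc_le by blast+

lemma shift_bdd: "bounded_derivs S w k (\<lambda>s x. potential_shift V \<gamma> (e s) (v s x))"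
  by (rule bounded_derivs_expansion(2)[OF e weight_bounds(1) v_nonneg v_bdd])

lemma scaled_weight: "s \<in> S \<Longrightarrow> 0 \<le> e s * w s x"
  using e[of s] weight_bounds(2)[of s x] by simp

text \<open>The difference r of \<psi> and \<open>n_KdV\<close> satisfies r'' = (2 V \<gamma> - V^2
  (\<psi> + \<open>n_KdV\<close>)) r + O(\<epsilon>). This is linear in r with coefficients bounded
  in all derivatives, so the smallness \<open>e s * w s x\<close> known at order zero passes to
  every order.\<close>

lemma profile_difference_bdd:
  "bounded_derivs S (\<lambda>s x. e s * w s x) k (\<lambda>s x. \<psi> s x - n_KdV \<sigma> \<gamma> x)"
proof -
  obtain Q' where Q: "\<And>x. (n_KdV \<sigma> \<gamma> has_real_derivative Q' x) (at x)"
    "\<And>x. (Q' has_real_derivative (2 * V * \<gamma>) * n_KdV \<sigma> \<gamma> x - V\<^sup>2 * (n_KdV \<sigma> \<gamma> x)\<^sup>2) (at x)"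
    by (rule n_KdV_ode[OF \<sigma> \<gamma> V]) blast
  let ?q = "\<lambda>s x. n_KdV \<sigma> \<gamma> x" and ?r = "\<lambda>s x. \<psi> s x - n_KdV \<sigma> \<gamma> x"
  have r0: "bounded_derivs S (\<lambda>s x. e s * w s x) 0 ?r"
    using close by (auto simp: \<psi>_def w_def)
  \<comment> \<open>The decay of the KdV profile is read off from that of \<psi> and of the
    difference.\<close>
  have q0: "bounded_derivs S w 0 ?q"
  proof -
    have "bounded_derivs S w 0 ?r"
    proof (rule bounded_derivs_mono[OF r0, where K = 1])
      fix s x assume "s \<in> S"
      then have "e s * w s x \<le> 1 * w s x"
        using e[of s] weight_bounds(2)[of s x] by (intro mult_right_mono) auto
      then show "0 \<le> e s * w s x \<and> e s * w s x \<le> 1 * w s x"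
        using scaled_weight[OF \<open>s \<in> S\<close>, of x] by blast
    qed
    from bounded_derivs_diff[OF base_bounds(2) this weight_bounds(2)] show ?thesis by simp
  qed
  have Q_step: "bounded_derivs S w (Suc (Suc k)) ?q" if "bounded_derivs S w k ?q" for k
  proof -
    have "bounded_derivs S w k (\<lambda>s x. (2 * V * \<gamma>) * n_KdV \<sigma> \<gamma> x - V\<^sup>2 * (n_KdV \<sigma> \<gamma> x)\<^sup>2)"
      by (intro bounded_derivs_diff bounded_derivs_mult_left[where w = w] bounded_derivs_const
          bounded_derivs_power_Suc[where w = w] that unit_weight[OF that] weight_bounds(2)) simp
    then show ?thesis
      using bounded_derivs_interpolation[where a = "\<lambda>_. 1" and S = S and f = ?q, OF Q \<beta>, where k = k] q0
      by (simp add: w_def[abs_def])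
  qed
  have Q_bdd: "bounded_derivs S w k ?q" for k
  proof (induction k)
    case (Suc k)
    then show ?case using Q_step bounded_derivs_Suc_le by blast
  qed (rule q0)
  have r_step: "bounded_derivs S (\<lambda>s x. e s * w s x) (Suc (Suc k)) ?r"
    if r: "bounded_derivs S (\<lambda>s x. e s * w s x) k ?r" for k
  proof -
    have d1: "(?r s has_real_derivative deriv (\<phi> s) x / e s - Q' x) (at x)" if "s \<in> S" for s x
      by (intro DERIV_diff scaled_derivs(2)[OF that] Q)
    have d2: "((\<lambda>x. deriv (\<phi> s) x / e s - Q' x) has_real_derivative
        (2 * V * \<gamma> - V\<^sup>2 * (\<psi> s x + n_KdV \<sigma> \<gamma> x)) * ?r s x
          + e s * ode_remainder V \<gamma> (e s) (v s x) (\<psi> s x)) (at x)" if "s \<in> S" for s x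
    proof -
      have "potential_shift V \<gamma> (e s) (v s x) + (1/2) * (\<psi> s x)\<^sup>2 + e s * exp_remainder (e s) (\<psi> s x)
          = (2 * V * \<gamma>) * \<psi> s x - V\<^sup>2 * (\<psi> s x)\<^sup>2 + e s * ode_remainder V \<gamma> (e s) (v s x) (\<psi> s x)"
        using wave_scaled(2,3)[OF family_facts[OF that], of x] by (simp add: v_def \<psi>_def)
      then have eq: "potential_shift V \<gamma> (e s) (v s x) + (1/2) * (\<psi> s x)\<^sup>2 + e s * exp_remainder (e s) (\<psi> s x)
          - ((2 * V * \<gamma>) * n_KdV \<sigma> \<gamma> x - V\<^sup>2 * (n_KdV \<sigma> \<gamma> x)\<^sup>2)
          = (2 * V * \<gamma> - V\<^sup>2 * (\<psi> s x + n_KdV \<sigma> \<gamma> x)) * ?r s x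
          + e s * ode_remainder V \<gamma> (e s) (v s x) (\<psi> s x)"
        by (simp add: algebra_simps power2_eq_square)
      show ?thesis by (rule DERIV_cong[OF DERIV_diff[OF scaled_derivs(3)[OF that] Q(2)] eq])
    qed
    have "bounded_derivs S (\<lambda>s x. e s * w s x) k
        (\<lambda>s x. (2 * V * \<gamma> - V\<^sup>2 * (\<psi> s x + n_KdV \<sigma> \<gamma> x)) * ?r s x
          + e s * ode_remainder V \<gamma> (e s) (v s x) (\<psi> s x))"
    proof (rule bounded_derivs_add)
      have "bounded_derivs S (\<lambda>_ _. 1) k (\<lambda>s x. 2 * V * \<gamma> - V\<^sup>2 * (\<psi> s x + n_KdV \<sigma> \<gamma> x))"
        by (intro bounded_derivs_diff bounded_derivs_mult_left bounded_derivs_add bounded_derivs_const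
            unit_weight[OF psi_bdd] unit_weight[OF Q_bdd]) auto
      then show "bounded_derivs S (\<lambda>s x. e s * w s x) k
          (\<lambda>s x. (2 * V * \<gamma> - V\<^sup>2 * (\<psi> s x + n_KdV \<sigma> \<gamma> x)) * ?r s x)"
        by (rule bounded_derivs_mult_left[OF _ r scaled_weight])
      have "bounded_derivs S w k (\<lambda>s x. ode_remainder V \<gamma> (e s) (v s x) (\<psi> s x))"
        by (rule bounded_derivs_expansion(3)[OF e weight_bounds(1) v_nonneg v_bdd psi_nonneg psi_bdd])
      then show "bounded_derivs S (\<lambda>s x. e s * w s x) k
          (\<lambda>s x. e s * ode_remainder V \<gamma> (e s) (v s x) (\<psi> s x))"
        by (rule bounded_derivs_scale) (use e weight_bounds(2) in \<open>auto intro: less_imp_le\<close>)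
    qed
    then show ?thesis
      using bounded_derivs_interpolation[where a = e and S = S, OF d1 d2 \<beta>, where k = k] r0 e
      by (simp add: w_def[abs_def] less_imp_le)
  qed
  show ?thesis
  proof (induction k)
    case (Suc k)
    then show ?case using r_step bounded_derivs_Suc_le by blast
  qed (rule r0)
qed

text \<open>The density differs from the scaled potential by \<epsilon> times a decaying term, so it
  has the same leading profile.\<close>

lemma density_difference_bdd:
  "bounded_derivs S (\<lambda>s x. e s * w s x) k (\<lambda>s x. v s x - n_KdV \<sigma> \<gamma> x)"
proof -
  have "bounded_derivs S (\<lambda>s x. e s * w s x) k
      (\<lambda>s x. (\<psi> s x - n_KdV \<sigma> \<gamma> x) - e s * potential_shift V \<gamma> (e s) (v s x))"
    by (intro bounded_derivs_diff profile_difference_bdd bounded_derivs_scale shift_bdd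
        scaled_weight weight_bounds(2)) (use e in \<open>auto intro: less_imp_le\<close>)
  moreover have "(\<psi> s x - n_KdV \<sigma> \<gamma> x) - e s * potential_shift V \<gamma> (e s) (v s x)
      = v s x - n_KdV \<sigma> \<gamma> x" if "s \<in> S" for s x
    using wave_scaled(1)[OF family_facts[OF that], of x] by (simp add: v_def \<psi>_def)
  ultimately show ?thesis by (simp cong: bounded_derivs_cong)
qed

lemma remainders_bdd:
  shows "bounded_derivs S (\<lambda>s x. e s * (e s * w s x)) k (\<lambda>s x. n s x - 1 - e s * n_KdV \<sigma> \<gamma> x)"
    and "bounded_derivs S (\<lambda>s x. e s * (e s * w s x)) k (\<lambda>s x. u s x - e s * V * n_KdV \<sigma> \<gamma> x)"
    and "bounded_derivs S (\<lambda>s x. e s * (e s * w s x)) k (\<lambda>s x. \<phi> s x - e s * n_KdV \<sigma> \<gamma> x)"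
proof -
  have e0: "\<And>s. s \<in> S \<Longrightarrow> e s \<ge> 0" using e by (simp add: less_imp_le)
  have scale: "bounded_derivs S (\<lambda>s x. e s * (e s * w s x)) k (\<lambda>s x. e s * f s x)"
    if "bounded_derivs S (\<lambda>s x. e s * w s x) k f" for f
    by (rule bounded_derivs_scale[OF that e0 scaled_weight])
  have "e s * (v s x - n_KdV \<sigma> \<gamma> x) = n s x - 1 - e s * n_KdV \<sigma> \<gamma> x" if "s \<in> S" for s x
    using n_v[OF that, of x] by (simp add: algebra_simps)
  from bounded_derivs_cong[OF this] scale[OF density_difference_bdd]
  show "bounded_derivs S (\<lambda>s x. e s * (e s * w s x)) k (\<lambda>s x. n s x - 1 - e s * n_KdV \<sigma> \<gamma> x)"
    by fast
  have "e s * (\<psi> s x - n_KdV \<sigma> \<gamma> x) = \<phi> s x - e s * n_KdV \<sigma> \<gamma> x" if "s \<in> S" for s x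
    using e[OF that] by (simp add: \<psi>_def right_diff_distrib)
  from bounded_derivs_cong[OF this] scale[OF profile_difference_bdd]
  show "bounded_derivs S (\<lambda>s x. e s * (e s * w s x)) k (\<lambda>s x. \<phi> s x - e s * n_KdV \<sigma> \<gamma> x)"
    by fast
  \<comment> \<open>Expanding (V + \<gamma> \<epsilon>) (1 - 1/n) in \<open>v\<close> with exact
    remainder: V v is the leading part, and both the excess speed and the quadratic term carry a
    further factor \<epsilon>.\<close>
  let ?U = "\<lambda>s x. V * (v s x - n_KdV \<sigma> \<gamma> x)
    + e s * (\<gamma> * v s x - (V + \<gamma> * e s) * (1 / (1 + e s * v s x)) * (v s x)\<^sup>2)"
  have U: "e s * ?U s x = u s x - e s * V * n_KdV \<sigma> \<gamma> x" if "s \<in> S" for s x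
  proof -
    have nz: "1 + e s * v s x \<noteq> 0" using n_gt_1[OF family_facts[OF that], of x] n_v[OF that, of x] by simp
    have "u s x = (V + \<gamma> * e s) * (1 - 1 / (1 + e s * v s x))"
      using velocity_eq[OF family_facts[OF that], of x] n_v[OF that, of x] by simp
    also have "1 - 1 / (1 + e s * v s x) = e s * v s x - (e s * v s x)\<^sup>2 * (1 / (1 + e s * v s x))"
      using nz by (simp add: divide_simps) (simp add: algebra_simps power2_eq_square)
    finally show ?thesis by (simp only:) (simp add: algebra_simps power2_eq_square)
  qed
  have "bounded_derivs S (\<lambda>s x. e s * w s x) k ?U"
  proof (intro bounded_derivs_add[where w = "\<lambda>s x. e s * w s x"] bounded_derivs_scale e0 weight_bounds(2))
    show "bounded_derivs S (\<lambda>s x. e s * w s x) k (\<lambda>s x. V * (v s x - n_KdV \<sigma> \<gamma> x))"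
      by (intro bounded_derivs_mult_left bounded_derivs_const density_difference_bdd scaled_weight)
    have "bounded_derivs S (\<lambda>_ _. 1) k (\<lambda>s x. 1 / (1 + e s * v s x))"
    proof (rule bounded_derivs_inverse[where c = 1])
      show "bounded_derivs S (\<lambda>_ _. 1) k (\<lambda>s x. 1 + e s * v s x)"
        by (intro bounded_derivs_add bounded_derivs_mult_left bounded_derivs_const unit_param
            unit_weight[OF v_bdd]) auto
    qed (use e0 v_nonneg in auto)
    then have "bounded_derivs S (\<lambda>_ _. 1) k (\<lambda>s x. (V + \<gamma> * e s) * (1 / (1 + e s * v s x)))"
      by (intro bounded_derivs_mult_left bounded_derivs_add bounded_derivs_const unit_param) auto
    then show "bounded_derivs S w k (\<lambda>s x. \<gamma> * v s x - (V + \<gamma> * e s) * (1 / (1 + e s * v s x)) * (v s x)\<^sup>2)"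
      by (intro bounded_derivs_diff bounded_derivs_mult_left[where w = w] bounded_derivs_const v_bdd
          bounded_derivs_power_Suc unit_weight[OF v_bdd] weight_bounds(2)) auto
  qed
  from bounded_derivs_cong[OF U] scale[OF this]
  show "bounded_derivs S (\<lambda>s x. e s * (e s * w s x)) k (\<lambda>s x. u s x - e s * V * n_KdV \<sigma> \<gamma> x)"
    by fast
qed

end

section \<open>Assembly of the weighted bound\<close>

text \<open>Supplies the assumption \<open>small\<close> of the bootstrap, since \<sigma> + 1/2 =
  V^2 - 1/2. As \<epsilon>^2 is at most \<epsilon>, the excess of \<sigma> m^2 over \<sigma> is at
  most L \<epsilon>; the added 1 in the denominator keeps it positive also for \<sigma> = 0.\<close>

lemma amplitude_bound:
  fixes \<sigma> K \<epsilon> m :: real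
  assumes "\<sigma> \<ge> 0" "K \<ge> 0" "0 < \<epsilon>" "\<epsilon> \<le> 1" and \<epsilon>: "\<epsilon> \<le> 1 / (2 * (\<sigma> * (2 * K + K\<^sup>2) + 1))"
    and m: "0 \<le> m" "(m - 1) / \<epsilon> \<le> K"
  shows "\<sigma> * m\<^sup>2 \<le> \<sigma> + 1/2"
proof -
  define L where "L = \<sigma> * (2 * K + K\<^sup>2)"
  have L: "L \<ge> 0" using assms by (simp add: L_def)
  have "m \<le> 1 + K * \<epsilon>" using m assms(3) by (simp add: field_simps)
  then have "m\<^sup>2 \<le> (1 + K * \<epsilon>)\<^sup>2" using m(1) by (rule power_mono)
  also have "\<dots> = 1 + 2 * K * \<epsilon> + K\<^sup>2 * (\<epsilon> * \<epsilon>)" by (simp add: algebra_simps power2_eq_square)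
  also have "\<dots> \<le> 1 + 2 * K * \<epsilon> + K\<^sup>2 * (1 * \<epsilon>)"
    using assms by (intro add_left_mono mult_left_mono mult_right_mono) auto
  finally have "\<sigma> * m\<^sup>2 \<le> \<sigma> * (1 + 2 * K * \<epsilon> + K\<^sup>2 * (1 * \<epsilon>))" using assms(1) by (rule mult_left_mono)
  also have "\<dots> = \<sigma> + L * \<epsilon>" by (simp add: L_def algebra_simps)
  also have "L * \<epsilon> \<le> (L + 1) * (1 / (2 * (L + 1)))"
    using \<epsilon> L assms(3) unfolding L_def[symmetric] by (intro mult_mono) auto
  also have "\<dots> = 1 / 2" using L by simp
  finally show ?thesis by simp
qed

text \<open>The Euclidean norm is at most the sum of the absolute values, and the exponential weight
  cancels the common decay.\<close>

lemma weighted_norm_bound: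
  fixes a b c :: real
  assumes "\<bar>a\<bar> \<le> A * (\<epsilon> * (\<epsilon> * exp (- \<beta> * t)))" "\<bar>b\<bar> \<le> B * (\<epsilon> * (\<epsilon> * exp (- \<beta> * t)))"
    "\<bar>c\<bar> \<le> C * (\<epsilon> * (\<epsilon> * exp (- \<beta> * t)))"
  shows "exp (\<beta> * t) * sqrt (a\<^sup>2 + b\<^sup>2 + c\<^sup>2) \<le> (A + B + C) * \<epsilon>\<^sup>2"
proof -
  have "sqrt (a\<^sup>2 + b\<^sup>2 + c\<^sup>2) \<le> sqrt ((\<bar>a\<bar> + \<bar>b\<bar> + \<bar>c\<bar>)\<^sup>2)"
    by (intro real_sqrt_le_mono) (simp add: power2_eq_square algebra_simps)
  also have "\<dots> \<le> (A + B + C) * (\<epsilon> * (\<epsilon> * exp (- \<beta> * t)))"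
    using assms by (simp add: algebra_simps)
  finally have "exp (\<beta> * t) * sqrt (a\<^sup>2 + b\<^sup>2 + c\<^sup>2)
      \<le> exp (\<beta> * t) * ((A + B + C) * (\<epsilon> * (\<epsilon> * exp (- \<beta> * t))))"
    by (intro mult_left_mono) auto
  also have "\<dots> = (A + B + C) * \<epsilon>\<^sup>2" by (simp add: exp_minus power2_eq_square)
  finally show ?thesis .
qed

theorem theorem1p2:
  fixes \<sigma> \<gamma> :: real
  assumes "\<sigma> \<ge> 0" and "\<gamma> > 0"
  shows "\<exists>\<epsilon>1 > 0. \<exists>\<alpha> > 0. \<forall>k::nat. \<exists>C > 0. \<forall>\<epsilon> n u \<phi>.
           0 < \<epsilon> \<and> \<epsilon> < \<epsilon>1 \<and> solitary_wave \<sigma> \<gamma> \<epsilon> n u \<phi> \<longrightarrow>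
           (\<forall>\<xi>. exp (\<alpha> * \<bar>\<xi>\<bar> / 2) *
              sqrt ((kderiv k (\<lambda>x. n x - 1 - \<epsilon> * n_KdV \<sigma> \<gamma> x) \<xi>)\<^sup>2
                  + (kderiv k (\<lambda>x. u x - \<epsilon> * sqrt (1 + \<sigma>) * n_KdV \<sigma> \<gamma> x) \<xi>)\<^sup>2
                  + (kderiv k (\<lambda>x. \<phi> x - \<epsilon> * n_KdV \<sigma> \<gamma> x) \<xi>)\<^sup>2)
              \<le> C * \<epsilon>\<^sup>2)"
proof -
  define V where "V = sqrt (1 + \<sigma>)"
  define \<beta> where "\<beta> = sqrt (2 * V * \<gamma>) / 2"
  define K where "K = 13 * \<gamma> / V"
  have V: "V > 0" "V\<^sup>2 = 1 + \<sigma>" using assms by (auto simp: V_def)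
  have \<beta>: "\<beta> > 0" and K: "K > 0" using V assms by (auto simp: \<beta>_def K_def)
  obtain \<epsilon>0 C where \<epsilon>0: "0 < \<epsilon>0" "\<epsilon>0 \<le> 1" and C: "C > 0"
    and est: "\<And>\<epsilon> n u \<phi> x. \<lbrakk>0 < \<epsilon>; \<epsilon> < \<epsilon>0; solitary_wave \<sigma> \<gamma> \<epsilon> n u \<phi>\<rbrakk> \<Longrightarrow>
      (n x - 1) / \<epsilon> \<le> K \<and>
      (n x - 1) / \<epsilon> \<le> C * exp (- \<beta> * \<bar>x\<bar>) \<and>
      \<phi> x / \<epsilon> \<le> C * exp (- \<beta> * \<bar>x\<bar>) \<and>
      \<bar>\<phi> x / \<epsilon> - n_KdV \<sigma> \<gamma> x\<bar> \<le> C * (\<epsilon> * exp (- \<beta> * \<bar>x\<bar>))"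
    unfolding \<beta>_def K_def by (rule solitary_wave_estimate[OF assms V_def]) blast
  define \<epsilon>1 where "\<epsilon>1 = min \<epsilon>0 (1 / (2 * (\<sigma> * (2 * K + K\<^sup>2) + 1)))"
  have "\<sigma> * (2 * K + K\<^sup>2) + 1 > 0" using assms K by (auto intro: add_nonneg_pos)
  then have "\<epsilon>1 > 0" using \<epsilon>0 by (simp add: \<epsilon>1_def)
  \<comment> \<open>The index set consists of all admissible quadruples, so a constant obtained for
    the family depends on neither \<epsilon> nor the wave.\<close>
  define S where "S = {(\<epsilon>, n, u, \<phi>). 0 < \<epsilon> \<and> \<epsilon> < \<epsilon>1 \<and> solitary_wave \<sigma> \<gamma> \<epsilon> n u \<phi>}"
  define e n u \<phi> where "e = (\<lambda>s :: real \<times> (real \<Rightarrow> real) \<times> (real \<Rightarrow> real) \<times> (real \<Rightarrow> real). fst s)"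
    and "n = (\<lambda>s :: real \<times> (real \<Rightarrow> real) \<times> (real \<Rightarrow> real) \<times> (real \<Rightarrow> real). fst (snd s))"
    and "u = (\<lambda>s :: real \<times> (real \<Rightarrow> real) \<times> (real \<Rightarrow> real) \<times> (real \<Rightarrow> real). fst (snd (snd s)))"
    and "\<phi> = (\<lambda>s :: real \<times> (real \<Rightarrow> real) \<times> (real \<Rightarrow> real) \<times> (real \<Rightarrow> real). snd (snd (snd s)))"
  have S: "0 < e s" "e s < \<epsilon>1" "solitary_wave \<sigma> \<gamma> (e s) (n s) (u s) (\<phi> s)" if "s \<in> S" for s
    using that by (auto simp: S_def e_def n_def u_def \<phi>_def)
  have lt: "e s < \<epsilon>0" "e s \<le> 1" "e s \<le> 1 / (2 * (\<sigma> * (2 * K + K\<^sup>2) + 1))" if "s \<in> S" for s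
    using S(2)[OF that] \<epsilon>0 by (auto simp: \<epsilon>1_def)
  note est' = est[OF S(1) lt(1) S(3)]
  have small: "\<sigma> * (n s x)\<^sup>2 \<le> V\<^sup>2 - 1/2" if "s \<in> S" for s x
  proof -
    have "0 \<le> n s x" using n_gt_1[OF assms S(1,3)[OF that] V_def refl, of x] by simp
    then have "\<sigma> * (n s x)\<^sup>2 \<le> \<sigma> + 1/2"
      using est'[OF that that that, of x] K S(1) lt(2,3) that
      by (intro amplitude_bound[OF assms(1), of K "e s"]) auto
    then show ?thesis using V(2) by simp
  qed
  have e: "0 < e s \<and> e s \<le> 1" if "s \<in> S" for s using S(1) lt(2) that by blast
  have decay: "(n s x - 1) / e s \<le> C * exp (- \<beta> * \<bar>x\<bar>)" "\<phi> s x / e s \<le> C * exp (- \<beta> * \<bar>x\<bar>)"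
    "\<bar>\<phi> s x / e s - n_KdV \<sigma> \<gamma> x\<bar> \<le> C * (e s * exp (- \<beta> * \<bar>x\<bar>))" if "s \<in> S" for s x
    using est'[OF that that that, of x] by blast+
  have remainders:
    "bounded_derivs S (\<lambda>s x. e s * (e s * exp (- \<beta> * \<bar>x\<bar>))) k (\<lambda>s x. n s x - 1 - e s * n_KdV \<sigma> \<gamma> x)"
    "bounded_derivs S (\<lambda>s x. e s * (e s * exp (- \<beta> * \<bar>x\<bar>))) k (\<lambda>s x. u s x - e s * V * n_KdV \<sigma> \<gamma> x)"
    "bounded_derivs S (\<lambda>s x. e s * (e s * exp (- \<beta> * \<bar>x\<bar>))) k (\<lambda>s x. \<phi> s x - e s * n_KdV \<sigma> \<gamma> x)" for k
    by (rule remainders_bdd[OF assms V_def less_imp_le[OF \<beta>] C e S(3) small decay]; assumption)+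
  \<comment> \<open>The exponent \<alpha> is taken to be 2 \<beta>, so the weight of the theorem is
    \<open>exp (\<beta> * \<bar>\<xi>\<bar>)\<close>, matching the decay rate of the family.\<close>
  have main: "\<exists>C > 0. \<forall>\<epsilon> n u \<phi>. 0 < \<epsilon> \<and> \<epsilon> < \<epsilon>1 \<and> solitary_wave \<sigma> \<gamma> \<epsilon> n u \<phi> \<longrightarrow>
      (\<forall>\<xi>. exp (2 * \<beta> * \<bar>\<xi>\<bar> / 2) *
         sqrt ((kderiv k (\<lambda>x. n x - 1 - \<epsilon> * n_KdV \<sigma> \<gamma> x) \<xi>)\<^sup>2
             + (kderiv k (\<lambda>x. u x - \<epsilon> * sqrt (1 + \<sigma>) * n_KdV \<sigma> \<gamma> x) \<xi>)\<^sup>2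
             + (kderiv k (\<lambda>x. \<phi> x - \<epsilon> * n_KdV \<sigma> \<gamma> x) \<xi>)\<^sup>2)
         \<le> C * \<epsilon>\<^sup>2)" for k
  proof -
    obtain C1 where C1: "\<forall>s\<in>S. \<forall>x. \<bar>kderiv k (\<lambda>x. n s x - 1 - e s * n_KdV \<sigma> \<gamma> x) x\<bar>
        \<le> C1 * (e s * (e s * exp (- \<beta> * \<bar>x\<bar>)))"
      using bounded_derivs_kderiv[OF remainders(1)] by blast
    obtain C2 where C2: "\<forall>s\<in>S. \<forall>x. \<bar>kderiv k (\<lambda>x. u s x - e s * V * n_KdV \<sigma> \<gamma> x) x\<bar>
        \<le> C2 * (e s * (e s * exp (- \<beta> * \<bar>x\<bar>)))"
      using bounded_derivs_kderiv[OF remainders(2)] by blast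
    obtain C3 where C3: "\<forall>s\<in>S. \<forall>x. \<bar>kderiv k (\<lambda>x. \<phi> s x - e s * n_KdV \<sigma> \<gamma> x) x\<bar>
        \<le> C3 * (e s * (e s * exp (- \<beta> * \<bar>x\<bar>)))"
      using bounded_derivs_kderiv[OF remainders(3)] by blast
    show ?thesis
    \<comment> \<open>The three constants come without a sign, so the absolute value and the added 1
      make the witness positive.\<close>
    proof (intro exI[of _ "\<bar>C1 + C2 + C3\<bar> + 1"] conjI allI impI)
      fix \<epsilon> n' u' \<phi>' \<xi>
      assume *: "0 < \<epsilon> \<and> \<epsilon> < \<epsilon>1 \<and> solitary_wave \<sigma> \<gamma> \<epsilon> n' u' \<phi>'"
      define s where "s = (\<epsilon>, n', u', \<phi>')"
      have "s \<in> S" using * by (simp add: S_def s_def)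
      have proj: "e s = \<epsilon>" "n s = n'" "u s = u'" "\<phi> s = \<phi>'"
        by (auto simp: s_def e_def n_def u_def \<phi>_def)
      note bounds = C1[rule_format, OF \<open>s \<in> S\<close>, of \<xi>] C2[rule_format, OF \<open>s \<in> S\<close>, of \<xi>]
        C3[rule_format, OF \<open>s \<in> S\<close>, of \<xi>]
      have "exp (\<beta> * \<bar>\<xi>\<bar>) *
         sqrt ((kderiv k (\<lambda>x. n' x - 1 - \<epsilon> * n_KdV \<sigma> \<gamma> x) \<xi>)\<^sup>2
             + (kderiv k (\<lambda>x. u' x - \<epsilon> * V * n_KdV \<sigma> \<gamma> x) \<xi>)\<^sup>2
             + (kderiv k (\<lambda>x. \<phi>' x - \<epsilon> * n_KdV \<sigma> \<gamma> x) \<xi>)\<^sup>2)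
         \<le> (C1 + C2 + C3) * \<epsilon>\<^sup>2"
        by (rule weighted_norm_bound[OF bounds[unfolded proj]])
      also have "\<dots> \<le> (\<bar>C1 + C2 + C3\<bar> + 1) * \<epsilon>\<^sup>2" by (intro mult_right_mono) auto
      finally show "exp (2 * \<beta> * \<bar>\<xi>\<bar> / 2) *
         sqrt ((kderiv k (\<lambda>x. n' x - 1 - \<epsilon> * n_KdV \<sigma> \<gamma> x) \<xi>)\<^sup>2
             + (kderiv k (\<lambda>x. u' x - \<epsilon> * sqrt (1 + \<sigma>) * n_KdV \<sigma> \<gamma> x) \<xi>)\<^sup>2
             + (kderiv k (\<lambda>x. \<phi>' x - \<epsilon> * n_KdV \<sigma> \<gamma> x) \<xi>)\<^sup>2)
         \<le> (\<bar>C1 + C2 + C3\<bar> + 1) * \<epsilon>\<^sup>2"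
        by (simp add: V_def)
    qed simp
  qed
  have "2 * \<beta> > 0" using \<beta> by simp
  then show ?thesis using \<open>\<epsilon>1 > 0\<close> main by blast
qed

end
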